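(* Let $L>0$ be the constant of the quadratic upper bound below and let $0<\alpha<2/L$. If the sequence $\{[w^k;z^k]\}\subset\mathbb{R}^{n+m}$ generated by the SARM iteration is bounded, then (1) it has finite length: $\sum_{k=1}^\infty\|[w^{k+1};z^{k+1}]-[w^k;z^k]\|_2<+\infty$; and (2) $\{[w^k;z^k]\}$ converges to a critical point $[w^*;z^*]$ of $H$.
   Context: Data: $y\in\mathbb{R}^m$, $X\in\mathbb{R}^{m\times n}$ with rows $x_i^T$, preconditioned so that $X^TX=I_n$. Fix $\delta>0$. $S(x)=\frac{1}{2\sqrt{\delta}}x^2+\frac{\sqrt\delta}{2}$ if $|x|<\sqrt\delta$, $S(x)=|x|$ if $|x|\ge\sqrt\delta$. $H(w,z)=\tfrac12\|y-Xw-z\|_2^2+\delta\sum_{i=1}^m\frac{|z_i|}{S(y_i-x_i^Tw)}$, with $\nabla_w H(w,z)=-X^T(y-Xw-z)+\delta X^Tv$, $v_i=\frac{|z_i|S'(y_i-x_i^Tw)}{S(y_i-x_i^Tw)^2}$. $T(x)=0$ if $|x|\le\sqrt\delta$, $T(x)=x-\delta/x$ if $|x|>\sqrt\delta$, componentwise. SARM iteration: $w^0=0$, $z^0=0$, $w^{k+1}=w^k-\alpha\nabla_wH(w^k,z^k)$, $z^{k+1}=T(y-Xw^{k+1})$. $L>0$ is a constant depending only on $\delta$ such that for all $w,w'$ and all $z$ with $|z_i|\le S(y_i-x_i^Tw)$: $H(w',z)\le H(w,z)+\nabla_wH(w,z)^T(w'-w)+\frac L2\|w'-w\|_2^2$.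 A critical point of $H$ is a point $u$ with $0\in\partial H(u)$, where $\partial$ is the limiting subdifferential: $\hat\partial\sigma(b)=\{u:\liminf_{a\to b,a\ne b}\frac{\sigma(a)-\sigma(b)-\langle u,a-b\rangle}{\|a-b\|}\ge0\}$, $\partial\sigma(x)=\{u:\exists x_k\to x,\sigma(x_k)\to\sigma(x),u_k\in\hat\partial\sigma(x_k),u_k\to u\}$. *)

theory Defs
  imports "HOL-Analysis.Analysis" "HOL-Library.Liminf_Limsup"
begin

text \<open>Vectors in R^n, R^m are real^'n, real^'m; X is an m x n matrix (real^'n^'m),
 row i of X is x_i^T, so x_i^T w = (X *v w) $ i.  The stacked vector [w;z] is the pair (w,z),
 whose product norm is the Euclidean norm of the stacked vector.\<close>

definition S :: "real \<Rightarrow> real \<Rightarrow> real" where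
  "S \<delta> x = (if \<bar>x\<bar> < sqrt \<delta> then x\<^sup>2 / (2 * sqrt \<delta>) + sqrt \<delta> / 2 else \<bar>x\<bar>)"

definition S' :: "real \<Rightarrow> real \<Rightarrow> real" where
  "S' \<delta> x = (if \<bar>x\<bar> < sqrt \<delta> then x / sqrt \<delta> else sgn x)"

definition H :: "real \<Rightarrow> real^'m \<Rightarrow> real^'n^'m \<Rightarrow> (real^'n) \<times> (real^'m) \<Rightarrow> real" where
  "H \<delta> y X u = (case u of (w, z) \<Rightarrow>
     (1/2) * (norm (y - X *v w - z))\<^sup>2
     + \<delta> * (\<Sum>i\<in>UNIV. \<bar>z $ i\<bar> / S \<delta> ((y - X *v w) $ i)))"

definition grad_w_H :: "real \<Rightarrow> real^'m \<Rightarrow> real^'n^'m \<Rightarrow> real^'n \<Rightarrow> real^'m \<Rightarrow> real^'n" where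
  "grad_w_H \<delta> y X w z =
     - (transpose X *v (y - X *v w - z))
     + \<delta> *\<^sub>R (transpose X *v
          (\<chi> i. \<bar>z $ i\<bar> * S' \<delta> ((y - X *v w) $ i) / (S \<delta> ((y - X *v w) $ i))\<^sup>2))"

definition T :: "real \<Rightarrow> real^'m \<Rightarrow> real^'m" where
  "T \<delta> v = (\<chi> i. if \<bar>v $ i\<bar> \<le> sqrt \<delta> then 0 else v $ i - \<delta> / v $ i)"

primrec sarm :: "real \<Rightarrow> real^'m \<Rightarrow> real^'n^'m \<Rightarrow> real \<Rightarrow> nat \<Rightarrow> (real^'n) \<times> (real^'m)" where
  "sarm \<delta> y X \<alpha> 0 = (0, 0)"
| "sarm \<delta> y X \<alpha> (Suc k) =
     (let w = fst (sarm \<delta> y X \<alpha> k); z = snd (sarm \<delta> y X \<alpha> k);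
          w' = w - \<alpha> *\<^sub>R grad_w_H \<delta> y X w z
      in (w', T \<delta> (y - X *v w')))"

definition frechet_subdiff :: "('a::real_inner \<Rightarrow> real) \<Rightarrow> 'a \<Rightarrow> 'a set" where
  "frechet_subdiff \<sigma> b = {u. Liminf (at b)
      (\<lambda>a. ereal ((\<sigma> a - \<sigma> b - inner u (a - b)) / norm (a - b))) \<ge> 0}"

definition limiting_subdiff :: "('a::real_inner \<Rightarrow> real) \<Rightarrow> 'a \<Rightarrow> 'a set" where
  "limiting_subdiff \<sigma> x = {u. \<exists>xs us. xs \<longlonglongrightarrow> x \<and> (\<lambda>k. \<sigma> (xs k)) \<longlonglongrightarrow> \<sigma> x
      \<and> (\<forall>k. us k \<in> frechet_subdiff \<sigma> (xs k)) \<and> us \<longlonglongrightarrow> u}"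

definition critical_point :: "('a::real_inner \<Rightarrow> real) \<Rightarrow> 'a \<Rightarrow> bool" where
  "critical_point \<sigma> x \<longleftrightarrow> 0 \<in> limiting_subdiff \<sigma> x"

end

theory Submission
  imports Defs "HOL-Computational_Algebra.Polynomial" "HOL-Library.Multiset"
begin

text \<open>
  Minimising \<open>H(w, \<cdot>)\<close> componentwise shows that \<open>T (y - X w)\<close> is the minimiser and that, writing
  \<open>F\<close> for the minimal value, \<open>\<nabla>\<^sub>w H(w, T (y - X w)) = \<nabla> F(w)\<close>. From the first step on, SARM is therefore gradient
  descent with step \<open>\<alpha> < 2 / L\<close> on \<open>F\<close>, which is semialgebraic with Lipschitz gradient.

  The finite length is Kurdyka's argument for such functions. By the Tarski-Seidenberg theorem one can choose
  semialgebraically a point \<open>x(t)\<close> of least gradient norm on the part of the level set \<open>F = t\<close> in a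
  ball containing the iterates. The curve \<open>x\<close> has bounded variation, since each of its coordinates
  crosses every level a uniformly bounded number of times. Every level \<open>t\<close> between \<open>F(w\<^sup>k\<^sup>+\<^sup>1)\<close> and \<open>F(w\<^sup>k)\<close>
  is attained on the segment from \<open>w\<^sup>k\<close> to \<open>w\<^sup>k\<^sup>+\<^sup>1\<close>, where the gradient is comparable to the
  one at \<open>w\<^sup>k\<close>; hence the decrease of \<open>F\<close> is at most a constant times \<open>|\<nabla> F(w\<^sup>k)|\<close> times the variation of \<open>x\<close>
  over that range of levels. As the decrease is at least a constant times \<open>|\<nabla> F(w\<^sup>k)| |w\<^sup>k\<^sup>+\<^sup>1 - w\<^sup>k|\<close>, the steps
  are summable.

  At the limit \<open>\<nabla> F\<close> vanishes, and \<open>H \<ge> F\<close> with equality at the limit point, so that \<open>0\<close> is even a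
  Frechet subgradient of \<open>H\<close> there.
\<close>

section \<open>Sign patterns of univariate polynomials\<close>

text \<open>Of the selected curve only finite total variation is used. This tolerates jumps, asks
  for no continuity of the selection, and reduces to counting sign changes, hence to degrees of
  polynomials. The levels \<open>F (w k)\<close> decrease, so the level ranges of different steps
  share at most endpoints and the variations over them add up to a finite total. Quantifier
  elimination is needed only in this form: an existential quantifier preserves being decided by
  finitely many polynomial signs. Instead of rewriting formulas, two parameter values are compared.
  If suitable polynomial signs agree at both, an increasing bijection of the line carries the sign
  pattern of the whole family at one value to that at the other, and with it the witnesses.
  \<open>F\<close> is never differentiated. Its gradient enters through a Lipschitz bound and
  through the quadratic upper bound, which \<open>F\<close> inherits from \<open>H\<close> because
  \<open>F\<close> lies below \<open>H\<close> and equals it at the minimising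
  \<open>z\<close>.\<close>

lemma poly_sgn_at_top:
  fixes p :: "real poly"
  shows "\<exists>M. \<forall>x\<ge>M. sgn (poly p x) = sgn (lead_coeff p)"
proof -
  consider "lead_coeff p > 0" | "lead_coeff p < 0" | "p = 0"
    by (metis leading_coeff_0_iff linorder_less_linear)
  then show ?thesis
  proof cases
    case 1
    then obtain M where "\<forall>x\<ge>M. poly p x \<ge> lead_coeff p" using poly_pinfty_gt_lc by blast
    with 1 show ?thesis by (metis order_less_le_trans sgn_pos)
  next
    case 2
    then have "lead_coeff (-p) > 0" by (simp add: lead_coeff_minus)
    then obtain M where "\<forall>x\<ge>M. poly (-p) x \<ge> lead_coeff (-p)" using poly_pinfty_gt_lc by blast
    then have "\<forall>x\<ge>M. poly p x < 0" using 2 by (auto simp: lead_coeff_minus intro: le_less_trans)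
    with 2 show ?thesis by (auto intro!: exI[of _ M])
  qed auto
qed

lemma poly_sgn_at_bot:
  fixes p :: "real poly"
  shows "\<exists>M. \<forall>x\<le>M. sgn (poly p x) = sgn (lead_coeff p) * (-1) ^ degree p"
proof -
  obtain M where M: "\<forall>x\<ge>M. sgn (poly (pcompose p [:0,-1:]) x) = sgn (lead_coeff (pcompose p [:0,-1:]))"
    using poly_sgn_at_top by blast
  have lc: "lead_coeff (pcompose p [:0,-1:]) = lead_coeff p * (-1) ^ degree p"
    by (subst lead_coeff_comp) auto
  have "sgn (poly p x) = sgn (lead_coeff p) * (-1) ^ degree p" if "x \<le> -M" for x
    using M[rule_format, of "-x"] that
    unfolding lc by (simp add: poly_pcompose sgn_mult del: lead_coeff_comp)
  then show ?thesis by blast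
qed

text \<open>A repair map: it moves one point inside an interval and fixes everything outside, so a
  sign matching can be corrected in one gap between roots without disturbing the others. For
  \<open>u \<le> v\<close> the graph is the broken line through \<open>(lo, lo)\<close>,
  \<open>(u, v)\<close>, \<open>(hi, hi)\<close>, continued by the diagonal; for
  \<open>v < u\<close> the inverse of such a map is taken.\<close>

lemma strict_mono_surj_moving_point:
  fixes lo u v hi :: real
  assumes "lo < u" "u < hi" "lo < v" "v < hi"
  shows "\<exists>h. strict_mono h \<and> surj h \<and> h u = v \<and> (\<forall>x. x \<le> lo \<or> hi \<le> x \<longrightarrow> h x = x)"
proof -
  have up: "\<exists>h. strict_mono h \<and> surj h \<and> h u = v \<and> (\<forall>x. x \<le> lo \<or> hi \<le> x \<longrightarrow> h x = x)"
    if a: "lo < u" "u \<le> v" "v < hi" for u v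
  proof -
    define s t where "s = (v - lo) / (u - lo)" and "t = (hi - v) / (hi - u)"
    have st: "s \<ge> 1" "0 < t" "t \<le> 1" using a by (auto simp: s_def t_def)
    define f g where "f x = lo + (x - lo) * s" and "g x = hi - (hi - x) * t" for x
    define h where "h x = max x (min (f x) (g x))" for x
    have fg: "f x < f y" "g x < g y" if "x < y" for x y
      using that st by (auto simp: f_def g_def)
    have mono: "strict_mono h"
    proof (rule strict_monoI)
      fix x y :: real assume "x < y"
      with fg[OF this] show "h x < h y" by (auto simp: h_def max_def min_def)
    qed
    have fu: "f u = v" "g u = v" using a by (auto simp: f_def g_def s_def t_def)
    have out: "h x = x" if "x \<le> lo \<or> hi \<le> x" for x
    proof (cases "x \<le> lo")
      case True
      then have "(x - lo) * s \<le> (x - lo) * 1" using st by (intro mult_left_mono_neg) auto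
      then show ?thesis by (simp add: h_def f_def max_def min_def)
    next
      case False
      then have "(x - hi) * t \<le> (x - hi) * 1" using st that by (intro mult_left_mono) auto
      then have "g x \<le> x" by (simp add: g_def algebra_simps)
      then show ?thesis by (simp add: h_def max_def min_def)
    qed
    have cont: "continuous_on UNIV h" unfolding h_def f_def g_def by (intro continuous_intros)
    have "surj h"
      unfolding surj_def
    proof
      fix y
      show "\<exists>x. y = h x"
      proof (cases "y \<le> lo \<or> hi \<le> y")
        case True then show ?thesis using out by metis
      next
        case False
        have "\<exists>x\<ge>lo. x \<le> hi \<and> h x = y"
          using False out[of lo] out[of hi] a
          by (intro IVT') (auto intro: continuous_on_subset[OF cont])
        then show ?thesis by blast
      qed
    qed
    moreover have "h u = v" using fu a by (simp add: h_def)
    ultimately show ?thesis using mono out by blast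
  qed
  show ?thesis
  proof (cases "u \<le> v")
    case True then show ?thesis using up assms by blast
  next
    case False
    then obtain h where h: "strict_mono h" "surj h" "h v = u" "\<forall>x. x \<le> lo \<or> hi \<le> x \<longrightarrow> h x = x"
      using up[of v u] assms by auto
    have inj: "inj h" using h(1) by (rule strict_mono_imp_inj_on)
    have "strict_mono (inv h)"
    proof (rule strict_monoI)
      fix x y :: real assume "x < y"
      then show "inv h x < inv h y"
        by (metis h(1,2) strict_mono_less surj_f_inv_f)
    qed
    moreover have "surj (inv h)" using inj by (rule inj_imp_surj_inv)
    moreover have "inv h u = v" using h(3) inj by (metis inv_f_f)
    moreover have "\<forall>x. x \<le> lo \<or> hi \<le> x \<longrightarrow> inv h x = x" using h(4) inj by (metis inv_f_f)
    ultimately show ?thesis by blast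
  qed
qed

lemma finite_set_gap:
  fixes R :: "real set"
  assumes "finite R" "A \<in> R" "B \<in> R" "A < x" "x < B" "x \<notin> R"
  obtains a b where "a \<in> R" "b \<in> R" "a < x" "x < b" "\<And>r. r \<in> R \<Longrightarrow> r \<le> a \<or> b \<le> r"
proof
  let ?L = "{r\<in>R. r < x}" and ?U = "{r\<in>R. x < r}"
  have ne: "?L \<noteq> {}" "?U \<noteq> {}" and fin: "finite ?L" "finite ?U" using assms by auto
  have "Max ?L \<in> ?L" "Min ?U \<in> ?U" using Max_in[OF fin(1) ne(1)] Min_in[OF fin(2) ne(2)] by auto
  then show "Max ?L \<in> R" "Min ?U \<in> R" "Max ?L < x" "x < Min ?U" by auto
  show "r \<le> Max ?L \<or> Min ?U \<le> r" if "r \<in> R" for r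
    using that assms(6) fin by (cases "r < x") (auto intro!: Max_ge Min_le)
qed

lemma poly_less_of_pderiv_pos:
  fixes p :: "real poly"
  assumes "\<And>z. a < z \<Longrightarrow> z < b \<Longrightarrow> poly (pderiv p) z > 0" "a \<le> x" "x < y" "y \<le> b"
  shows "poly p x < poly p y"
proof -
  obtain z where "x < z" "z < y" "poly p y - poly p x = (y - x) * poly (pderiv p) z"
    using poly_MVT[OF assms(3)] by blast
  moreover have "poly (pderiv p) z > 0" using assms \<open>x < z\<close> \<open>z < y\<close> by auto
  ultimately show ?thesis using assms(3) by (smt (verit) mult_pos_pos)
qed

lemma poly_sgn_eq_of_no_root:
  fixes p :: "real poly"
  assumes "\<And>z. min x y \<le> z \<Longrightarrow> z \<le> max x y \<Longrightarrow> poly p z \<noteq> 0"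
  shows "sgn (poly p x) = sgn (poly p y)"
proof -
  have *: "sgn (poly p x) = sgn (poly p y)" if "x < y" "\<And>z. x \<le> z \<Longrightarrow> z \<le> y \<Longrightarrow> poly p z \<noteq> 0" for x y
  proof -
    have "poly p x \<noteq> 0" "poly p y \<noteq> 0" using that by auto
    moreover have "\<not> poly p x * poly p y < 0" using poly_IVT[OF that(1)] that(2) by force
    ultimately show ?thesis by (auto simp: sgn_if mult_less_0_iff)
  qed
  show ?thesis
  proof (cases x y rule: linorder_cases)
    case less
    then show ?thesis using assms by (intro *) auto
  next
    case greater
    then have "sgn (poly p y) = sgn (poly p x)" using assms by (intro *) auto
    then show ?thesis by simp
  qed simp
qed

text \<open>An increasing function has the sign forced by its end values unless it passes from
  negative to positive; then only the position of its unique zero is free, and \<open>roots\<close>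
  settles that.\<close>

lemma sgn_match_on_monotone_gap:
  fixes p p' :: "real poly"
  assumes "a < b" "strict_mono \<phi>"
    and d: "\<And>z. a < z \<Longrightarrow> z < b \<Longrightarrow> poly (pderiv p) z > 0"
    and d': "\<And>z. \<phi> a < z \<Longrightarrow> z < \<phi> b \<Longrightarrow> poly (pderiv p') z > 0"
    and ends: "sgn (poly p a) = sgn (poly p' (\<phi> a))" "sgn (poly p b) = sgn (poly p' (\<phi> b))"
    and roots: "\<And>z. a < z \<Longrightarrow> z < b \<Longrightarrow> poly p z = 0 \<Longrightarrow> poly p' (\<phi> z) = 0"
    and x: "a < x" "x < b"
  shows "sgn (poly p x) = sgn (poly p' (\<phi> x))"
proof -
  have lt: "\<phi> u < \<phi> v" if "u < v" for u v using assms(2) that by (simp add: strict_mono_less)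
  have m: "poly p u < poly p v" "poly p' (\<phi> u) < poly p' (\<phi> v)" if "a \<le> u" "u < v" "v \<le> b" for u v
    using that poly_less_of_pderiv_pos[OF d, of u v] poly_less_of_pderiv_pos[OF d', of "\<phi> u" "\<phi> v"]
      lt[of a u] lt[of u v] lt[of v b] by (auto simp: le_less)
  consider "poly p a \<ge> 0" | "poly p b \<le> 0" | "poly p a < 0" "poly p b > 0" by linarith
  then show ?thesis
  proof cases
    case 1
    then have "poly p' (\<phi> a) \<ge> 0" using ends by (metis zero_le_sgn_iff)
    then show ?thesis using 1 m[of a x] x by auto
  next
    case 2
    then have "poly p' (\<phi> b) \<le> 0" using ends by (metis sgn_le_0_iff)
    then show ?thesis using 2 m[of x b] x by auto
  next
    case 3
    then obtain \<rho> where \<rho>: "a < \<rho>" "\<rho> < b" "poly p \<rho> = 0"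
      using poly_IVT_pos[OF \<open>a<b\<close>] by blast
    with roots have "poly p' (\<phi> \<rho>) = 0" by blast
    then show ?thesis using \<rho> m[of x \<rho>] m[of \<rho> x] x by (cases x \<rho> rule: linorder_cases) auto
  qed
qed

text \<open>Between neighbouring roots of the \<open>q j\<close> the derivative \<open>q j0\<close>
  has no zero, so \<open>p\<close> is strictly monotone there, and so is \<open>p'\<close> on the
  image gap. The signs at gap ends agree by \<open>roots\<close>, those near infinity by degree and
  leading coefficient. Hence a zero of \<open>p\<close> inside a gap forces one of \<open>p'\<close>
  inside the image gap, and it remains to change \<open>\<phi>\<close> inside gaps, where the signs
  of the \<open>q j\<close> are constant, until the zeros correspond.\<close>

lemma sgn_match_extend:
  fixes p p' :: "real poly" and q q' :: "'j \<Rightarrow> real poly" and \<phi> :: "real \<Rightarrow> real"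
  assumes J: "finite J" and nz: "\<And>j. j \<in> J \<Longrightarrow> q j \<noteq> 0"
    and \<phi>: "strict_mono \<phi>" "surj \<phi>"
    and sg: "\<And>j x. j \<in> J \<Longrightarrow> sgn (poly (q j) x) = sgn (poly (q' j) (\<phi> x))"
    and j0: "j0 \<in> J" "q j0 = pderiv p" "q' j0 = pderiv p'"
    and roots: "\<And>j x. j \<in> J \<Longrightarrow> poly (q j) x = 0 \<Longrightarrow> sgn (poly p x) = sgn (poly p' (\<phi> x))"
    and deg: "degree p = degree p'" "sgn (lead_coeff p) = sgn (lead_coeff p')"
  shows "\<exists>\<psi>. strict_mono \<psi> \<and> surj \<psi> \<and>
    (\<forall>j\<in>J. \<forall>x. sgn (poly (q j) x) = sgn (poly (q' j) (\<psi> x))) \<and>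
    (\<forall>x. sgn (poly p x) = sgn (poly p' (\<psi> x)))"
proof -
  define R where "R = (\<Union>j\<in>J. {x. poly (q j) x = 0})"
  have finR: "finite R" unfolding R_def using J nz by (auto intro: poly_roots_finite)
  have p0: "p \<noteq> 0" using nz[OF j0(1)] j0(2) by auto
  have \<phi>less: "\<phi> x < \<phi> y \<longleftrightarrow> x < y" and \<phi>le: "\<phi> x \<le> \<phi> y \<longleftrightarrow> x \<le> y" for x y
    using \<phi>(1) by (auto simp: strict_mono_less strict_mono_less_eq)
  obtain m1 where m1: "\<forall>r\<in>R. m1 \<le> r" using bdd_below_finite[OF finR] unfolding bdd_below_def by blast
  obtain m2 where m2: "\<forall>r\<in>R. r \<le> m2" using bdd_above_finite[OF finR] unfolding bdd_above_def by blast
  define \<sigma> where "\<sigma> = sgn (lead_coeff p) * (-1) ^ degree p"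
  define \<tau> where "\<tau> = sgn (lead_coeff p)"
  obtain M1 where M1: "\<forall>x\<le>M1. sgn (poly p x) = \<sigma>" using poly_sgn_at_bot unfolding \<sigma>_def by blast
  obtain M1' where M1': "\<forall>x\<le>M1'. sgn (poly p' x) = \<sigma>"
    using poly_sgn_at_bot[of p'] deg unfolding \<sigma>_def by auto
  obtain M2 where M2: "\<forall>x\<ge>M2. sgn (poly p x) = \<tau>" using poly_sgn_at_top unfolding \<tau>_def by blast
  obtain M2' where M2': "\<forall>x\<ge>M2'. sgn (poly p' x) = \<tau>"
    using poly_sgn_at_top[of p'] deg unfolding \<tau>_def by auto
  obtain a2 b2 where a2: "\<phi> a2 = M1'" and b2: "\<phi> b2 = M2'" using \<phi>(2) by (metis surjD)
  \<comment> \<open>\<open>A\<close> and \<open>B\<close> lie strictly beyond all roots of the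
    \<open>q j\<close>, and so far out that \<open>p\<close> beyond them and \<open>p'\<close>
    beyond their images have their final signs. Counting them as gap ends makes every gap bounded;
    the term \<open>A + 1\<close> in \<open>B\<close> gives \<open>A < B\<close> even when there are
    no roots.\<close>
  define A where "A = min M1 (min a2 (m1 - 1))"
  define B where "B = max (A + 1) (max M2 (max b2 (m2 + 1)))"
  have AB: "A < B" by (simp add: B_def)
  have A1: "sgn (poly p x) = \<sigma>" if "x \<le> A" for x using M1 that by (simp add: A_def)
  have A2: "sgn (poly p' x) = \<sigma>" if "x \<le> \<phi> A" for x
  proof -
    have "\<phi> A \<le> M1'" unfolding a2[symmetric] \<phi>le by (simp add: A_def)
    then show ?thesis using M1' that by simp
  qed
  have B1: "sgn (poly p x) = \<tau>" if "x \<ge> B" for x using M2 that by (simp add: B_def)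
  have B2: "sgn (poly p' x) = \<tau>" if "x \<ge> \<phi> B" for x
  proof -
    have "\<phi> B \<ge> M2'" unfolding b2[symmetric] \<phi>le by (simp add: B_def)
    then show ?thesis using M2' that by simp
  qed
  define R' where "R' = insert A (insert B R)"
  have finR': "finite R'" using finR by (simp add: R'_def)
  have R'match: "sgn (poly p r) = sgn (poly p' (\<phi> r))" if "r \<in> R'" for r
    using that roots A1[of A] A2[of "\<phi> A"] B1[of B] B2[of "\<phi> B"] unfolding R'_def R_def by auto
  define gap where "gap a b \<longleftrightarrow> a \<in> R' \<and> b \<in> R' \<and> a < b \<and> (\<forall>r\<in>R'. r \<le> a \<or> b \<le> r)" for a b
  have gapE: "\<exists>a b. gap a b \<and> a < x \<and> x < b" if "A < x" "x < B" "x \<notin> R'" for x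
    using finite_set_gap[OF finR' _ _ that] unfolding gap_def R'_def
    by (smt (verit) insertCI)
  have gapR: "poly (q j) z \<noteq> 0" if "gap a b" "a < z" "z < b" "j \<in> J" for a b z j
    using that unfolding gap_def R'_def R_def by fastforce
  have gapq: "sgn (poly (q j) u) = sgn (poly (q j) v)"
    if "gap a b" "a < u" "u < b" "a < v" "v < b" "j \<in> J" for a b u v j
    by (rule poly_sgn_eq_of_no_root, rule gapR) (use that in auto)
  have gapq': "sgn (poly (q' j) u) = sgn (poly (q' j) v)"
    if "gap a b" "\<phi> a < u" "u < \<phi> b" "\<phi> a < v" "v < \<phi> b" "j \<in> J" for a b u v j
  proof -
    obtain u0 v0 where "u = \<phi> u0" "v = \<phi> v0" using \<phi>(2) by (metis surjD)
    then show ?thesis using gapq[of a b u0 v0 j] sg that by (auto simp: \<phi>less)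
  qed
  \<comment> \<open>The decreasing case is expressed as increase of \<open>-p\<close> and
    \<open>-p'\<close>; the same alternative holds on both sides because \<open>q j0\<close> and
    \<open>q' j0\<close> are sign matched.\<close>
  have gapd: "(\<forall>z. a < z \<and> z < b \<longrightarrow> poly (pderiv p) z > 0) \<and> (\<forall>z. \<phi> a < z \<and> z < \<phi> b \<longrightarrow> poly (pderiv p') z > 0)
    \<or> (\<forall>z. a < z \<and> z < b \<longrightarrow> poly (pderiv (-p)) z > 0) \<and> (\<forall>z. \<phi> a < z \<and> z < \<phi> b \<longrightarrow> poly (pderiv (-p')) z > 0)"
    if g: "gap a b" for a b
  proof -
    define c where "c = (a + b) / 2"
    have c: "a < c" "c < b" using g unfolding gap_def c_def by auto
    then have c': "\<phi> a < \<phi> c" "\<phi> c < \<phi> b" by (auto simp: \<phi>less)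
    define s where "s = sgn (poly (pderiv p) c)"
    have s0: "s \<noteq> 0" using gapR[OF g c j0(1)] by (simp add: s_def j0 sgn_zero_iff)
    have s1: "sgn (poly (pderiv p) z) = s" if "a < z" "z < b" for z
      using gapq[OF g that c j0(1)] by (simp add: s_def j0)
    have s2: "sgn (poly (pderiv p') z) = s" if "\<phi> a < z" "z < \<phi> b" for z
      using gapq'[OF g that c' j0(1)] sg[OF j0(1), of c] by (simp add: s_def j0)
    show ?thesis
    proof (cases "s > 0")
      case True
      then show ?thesis using s1 s2 by (metis sgn_greater)
    next
      case False
      then have "s < 0" using s0 by simp
      then show ?thesis using s1 s2 by (simp add: pderiv_minus) (metis sgn_less)
    qed
  qed
  have root_unique: "u = v" if g: "gap a b" and "a < u" "u < b" "a < v" "v < b" "poly p u = 0" "poly p v = 0" for a b u v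
  proof (rule ccontr)
    assume "u \<noteq> v"
    then show False
      using gapd[OF g] poly_less_of_pderiv_pos[of a b p u v] poly_less_of_pderiv_pos[of a b p v u]
        poly_less_of_pderiv_pos[of a b "-p" u v] poly_less_of_pderiv_pos[of a b "-p" v u] that
      by (cases u v rule: linorder_cases) auto
  qed
  have root_hat: "\<exists>z. \<phi> a < z \<and> z < \<phi> b \<and> poly p' z = 0"
    if g: "gap a b" and \<rho>: "a < \<rho>" "\<rho> < b" "poly p \<rho> = 0" for a b \<rho>
  proof -
    have "poly p a * poly p b < 0"
      using gapd[OF g]
    proof
      assume h: "(\<forall>z. a < z \<and> z < b \<longrightarrow> poly (pderiv p) z > 0) \<and> (\<forall>z. \<phi> a < z \<and> z < \<phi> b \<longrightarrow> poly (pderiv p') z > 0)"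
      show ?thesis
        using poly_less_of_pderiv_pos[of a b p a \<rho>] poly_less_of_pderiv_pos[of a b p \<rho> b] h \<rho>
        by (simp add: mult_neg_pos)
    next
      assume h: "(\<forall>z. a < z \<and> z < b \<longrightarrow> poly (pderiv (-p)) z > 0) \<and> (\<forall>z. \<phi> a < z \<and> z < \<phi> b \<longrightarrow> poly (pderiv (-p')) z > 0)"
      show ?thesis
        using poly_less_of_pderiv_pos[of a b "-p" a \<rho>] poly_less_of_pderiv_pos[of a b "-p" \<rho> b] h \<rho>
        by (simp add: mult_pos_neg)
    qed
    then have "sgn (poly p a) * sgn (poly p b) < 0" by (simp flip: sgn_mult)
    then have "poly p' (\<phi> a) * poly p' (\<phi> b) < 0"
      using R'match[of a] R'match[of b] g unfolding gap_def by (simp flip: sgn_mult)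
    moreover have "\<phi> a < \<phi> b" using g by (simp add: gap_def \<phi>less)
    ultimately show ?thesis using poly_IVT by blast
  qed
  define N where "N = {\<rho>. A < \<rho> \<and> \<rho> < B \<and> \<rho> \<notin> R' \<and> poly p \<rho> = 0}"
  have finN: "finite N" using poly_roots_finite[OF p0] by (rule rev_finite_subset) (auto simp: N_def)
  \<comment> \<open>Induction over the zeros of \<open>p\<close> inside gaps: each is sent to a zero
    of \<open>p'\<close> by a repair map composed after the current matching. Zeros treated earlier
    survive, since a gap contains at most one zero of \<open>p\<close> and the repair map fixes
    everything outside the image gap.\<close>
  have "\<exists>\<psi>. strict_mono \<psi> \<and> surj \<psi> \<and> (\<forall>r\<in>R'. \<psi> r = \<phi> r) \<and>
      (\<forall>j\<in>J. \<forall>x. sgn (poly (q j) x) = sgn (poly (q' j) (\<psi> x))) \<and> (\<forall>\<rho>\<in>W. poly p' (\<psi> \<rho>) = 0)"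
    if "finite W" "W \<subseteq> N" for W
    using that
  proof (induction W rule: finite_induct)
    case empty
    then show ?case using \<phi> sg by auto
  next
    case (insert \<rho> W)
    then obtain \<psi> where \<psi>: "strict_mono \<psi>" "surj \<psi>" "\<forall>r\<in>R'. \<psi> r = \<phi> r"
      "\<forall>j\<in>J. \<forall>x. sgn (poly (q j) x) = sgn (poly (q' j) (\<psi> x))" "\<forall>\<rho>\<in>W. poly p' (\<psi> \<rho>) = 0" by auto
    have \<psi>less: "\<psi> x < \<psi> y \<longleftrightarrow> x < y" and \<psi>le: "\<psi> x \<le> \<psi> y \<longleftrightarrow> x \<le> y" for x y
      using \<psi>(1) by (auto simp: strict_mono_less strict_mono_less_eq)
    have \<rho>: "A < \<rho>" "\<rho> < B" "\<rho> \<notin> R'" "poly p \<rho> = 0" using insert.prems by (auto simp: N_def)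
    then obtain a b where g: "gap a b" "a < \<rho>" "\<rho> < b" using gapE by blast
    then have ab: "\<psi> a = \<phi> a" "\<psi> b = \<phi> b" using \<psi>(3) by (auto simp: gap_def)
    obtain z where z: "\<phi> a < z" "z < \<phi> b" "poly p' z = 0" using root_hat[OF g \<rho>(4)] by blast
    have "\<phi> a < \<psi> \<rho>" "\<psi> \<rho> < \<phi> b" using g by (auto simp: ab[symmetric] \<psi>less)
    then obtain h where h: "strict_mono h" "surj h" "h (\<psi> \<rho>) = z" "\<forall>x. x \<le> \<phi> a \<or> \<phi> b \<le> x \<longrightarrow> h x = x"
      using strict_mono_surj_moving_point[of "\<phi> a" "\<psi> \<rho>" "\<phi> b" z] z by blast
    have out: "h (\<psi> x) = \<psi> x" if "x \<le> a \<or> b \<le> x" for x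
      using h(4) that by (auto simp: ab[symmetric] \<psi>le)
    have inn: "\<phi> a < h (\<psi> x) \<and> h (\<psi> x) < \<phi> b" if "a < x" "x < b" for x
    proof -
      have "h (\<psi> a) < h (\<psi> x)" "h (\<psi> x) < h (\<psi> b)"
        using h(1) that by (simp_all add: strict_mono_less \<psi>less)
      then show ?thesis using out[of a] out[of b] ab by simp
    qed
    have "strict_mono (h \<circ> \<psi>)" using h(1) \<psi>(1) by (simp add: strict_mono_def)
    moreover have "surj (h \<circ> \<psi>)" using h(2) \<psi>(2) by (rule comp_surj[rotated])
    moreover have "\<forall>r\<in>R'. (h \<circ> \<psi>) r = \<phi> r"
      using \<psi>(3) out g(1) unfolding gap_def by (metis comp_apply)
    moreover have "sgn (poly (q j) x) = sgn (poly (q' j) ((h \<circ> \<psi>) x))" if j: "j \<in> J" for j x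
    proof (cases "a < x \<and> x < b")
      case True
      then have "\<phi> a < \<psi> x" "\<psi> x < \<phi> b" by (auto simp: ab[symmetric] \<psi>less)
      then have "sgn (poly (q' j) (\<psi> x)) = sgn (poly (q' j) (h (\<psi> x)))"
        using inn[of x] True gapq'[OF g(1) _ _ _ _ j] by blast
      then show ?thesis using \<psi>(4) j by simp
    next
      case False
      then show ?thesis using \<psi>(4) j out[of x] by auto
    qed
    moreover have "poly p' ((h \<circ> \<psi>) r) = 0" if "r \<in> insert \<rho> W" for r
    proof (cases "r = \<rho>")
      case True then show ?thesis using h z by simp
    next
      case False
      then have r: "r \<in> W" "poly p r = 0" using that insert.prems by (auto simp: N_def)
      then have "\<not> (a < r \<and> r < b)" using root_unique[OF g(1), of r \<rho>] g \<rho>(4) False by blast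
      then show ?thesis using out[of r] \<psi>(5) r by auto
    qed
    ultimately show ?case by blast
  qed
  from this[OF finN subset_refl] obtain \<psi> where \<psi>: "strict_mono \<psi>" "surj \<psi>" "\<forall>r\<in>R'. \<psi> r = \<phi> r"
      "\<forall>j\<in>J. \<forall>x. sgn (poly (q j) x) = sgn (poly (q' j) (\<psi> x))" "\<forall>\<rho>\<in>N. poly p' (\<psi> \<rho>) = 0" by blast
  have "sgn (poly p x) = sgn (poly p' (\<psi> x))" for x
  proof -
    consider "x \<le> A" | "x \<ge> B" | "A < x" "x < B" "x \<in> R'" | "A < x" "x < B" "x \<notin> R'" by linarith
    then show ?thesis
    proof cases
      case 1
      then have "\<psi> x \<le> \<phi> A" using \<psi>(1,3) unfolding R'_def by (metis insertI1 strict_mono_less_eq)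
      then show ?thesis using A1 A2 1 by simp
    next
      case 2
      then have "\<psi> x \<ge> \<phi> B" using \<psi>(1,3) unfolding R'_def by (metis insertI1 insertI2 strict_mono_less_eq)
      then show ?thesis using B1 B2 2 by simp
    next
      case 3
      then show ?thesis using R'match \<psi>(3) by simp
    next
      case 4
      then obtain a b where g: "gap a b" "a < x" "x < b" using gapE by blast
      then have ab: "\<psi> a = \<phi> a" "\<psi> b = \<phi> b" "a \<in> R'" "b \<in> R'" "a < b"
        and AB': "A \<le> a" "b \<le> B" and no: "\<And>r. r \<in> R' \<Longrightarrow> r \<le> a \<or> b \<le> r"
        using \<psi>(3) 4 by (auto simp: gap_def R'_def)
      have rt: "poly p' (\<psi> z) = 0" if "a < z" "z < b" "poly p z = 0" for z
      proof -
        have "z \<notin> R'" using no[of z] that by auto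
        then have "z \<in> N" using that AB' by (simp add: N_def)
        then show ?thesis using \<psi>(5) by blast
      qed
      have ends: "sgn (poly p a) = sgn (poly p' (\<psi> a))" "sgn (poly p b) = sgn (poly p' (\<psi> b))"
        using R'match[OF ab(3)] R'match[OF ab(4)] ab(1,2) by simp_all
      show ?thesis using gapd[OF g(1)]
      proof
        assume "(\<forall>z. a < z \<and> z < b \<longrightarrow> poly (pderiv p) z > 0) \<and> (\<forall>z. \<phi> a < z \<and> z < \<phi> b \<longrightarrow> poly (pderiv p') z > 0)"
        then show ?thesis
          using ab(1,2) by (intro sgn_match_on_monotone_gap[OF ab(5) \<psi>(1) _ _ ends rt g(2,3)]) simp_all
      next
        assume d: "(\<forall>z. a < z \<and> z < b \<longrightarrow> poly (pderiv (-p)) z > 0) \<and> (\<forall>z. \<phi> a < z \<and> z < \<phi> b \<longrightarrow> poly (pderiv (-p')) z > 0)"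
        have ends': "sgn (poly (-p) a) = sgn (poly (-p') (\<psi> a))" "sgn (poly (-p) b) = sgn (poly (-p') (\<psi> b))"
          using ends by (simp_all add: sgn_minus)
        have rt': "poly (-p') (\<psi> z) = 0" if "a < z" "z < b" "poly (-p) z = 0" for z
          using rt[of z] that by simp
        have "sgn (poly (-p) x) = sgn (poly (-p') (\<psi> x))"
          using ab(1,2) d by (intro sgn_match_on_monotone_gap[OF ab(5) \<psi>(1) _ _ ends' rt' g(2,3)]) simp_all
        then show ?thesis by (simp add: sgn_minus)
      qed
    qed
  qed
  then show ?thesis using \<psi> by blast
qed

section \<open>Sign patterns of polynomials with parameters\<close>

text \<open>Polynomials are taken as functions of an environment over an arbitrary index type of
  variables. Substitution is then composition, and bound variables, free variables and parameters
  are told apart by the index type, for instance a sum or an option type.\<close>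

inductive_set polyfun :: "(('v \<Rightarrow> real) \<Rightarrow> real) set" where
  polyfun_const: "(\<lambda>e. c) \<in> polyfun"
| polyfun_var: "(\<lambda>e. e v) \<in> polyfun"
| polyfun_add: "f \<in> polyfun \<Longrightarrow> g \<in> polyfun \<Longrightarrow> (\<lambda>e. f e + g e) \<in> polyfun"
| polyfun_mult: "f \<in> polyfun \<Longrightarrow> g \<in> polyfun \<Longrightarrow> (\<lambda>e. f e * g e) \<in> polyfun"

lemma polyfun_minus: "f \<in> polyfun \<Longrightarrow> (\<lambda>e. - f e) \<in> polyfun"
  using polyfun_mult[OF polyfun_const[of "-1"], of f] by simp

lemma polyfun_diff: "f \<in> polyfun \<Longrightarrow> g \<in> polyfun \<Longrightarrow> (\<lambda>e. f e - g e) \<in> polyfun"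
  using polyfun_add[OF _ polyfun_minus, of f g] by simp

lemma polyfun_sum: "(\<And>i. i \<in> I \<Longrightarrow> f i \<in> polyfun) \<Longrightarrow> (\<lambda>e. \<Sum>i\<in>I. f i e) \<in> polyfun"
  by (induction I rule: infinite_finite_induct) (auto intro: polyfun_const polyfun_add)

lemma polyfun_power: "f \<in> polyfun \<Longrightarrow> (\<lambda>e. f e ^ n) \<in> polyfun"
  by (induction n) (auto intro: polyfun_const polyfun_mult)

lemma polyfun_compose:
  assumes "f \<in> polyfun" "\<And>v. (\<lambda>e. \<sigma> e v) \<in> polyfun"
  shows "(\<lambda>e. f (\<sigma> e)) \<in> polyfun"
  using assms(1)
proof induction
  case (polyfun_const c)
  show ?case by (rule polyfun.polyfun_const)
next
  case (polyfun_var v)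
  show ?case by (rule assms(2))
next
  case (polyfun_add f g)
  then show ?case by (intro polyfun.polyfun_add)
next
  case (polyfun_mult f g)
  then show ?case by (intro polyfun.polyfun_mult)
qed

lemmas polyfun_intros = polyfun_const polyfun_var polyfun_add polyfun_mult polyfun_minus
  polyfun_diff polyfun_sum polyfun_power

text \<open>\<open>d\<close> is a formal degree: at some \<open>e\<close> the coefficient of index
  \<open>d\<close> may vanish and the actual degree drops, a case that elimination has to treat
  separately.\<close>

definition param_poly :: "nat \<Rightarrow> (('v \<Rightarrow> real) \<Rightarrow> real poly) \<Rightarrow> bool" where
  "param_poly d c \<longleftrightarrow> (\<forall>i. (\<lambda>e. coeff (c e) i) \<in> polyfun) \<and> (\<forall>e. degree (c e) \<le> d)"

lemma polyfun_as_param_poly: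
  fixes f :: "('v \<Rightarrow> real) \<Rightarrow> real"
  assumes "f \<in> polyfun"
  shows "\<exists>c d. param_poly d c \<and> (\<forall>e x. f (e(v := x)) = poly (c e) x)"
  using assms
proof induction
  case (polyfun_const a)
  have "param_poly 0 (\<lambda>e::'v\<Rightarrow>real. [:a:])"
    by (auto simp: param_poly_def coeff_pCons split: nat.split intro: polyfun_intros)
  then show ?case by (intro exI[of _ "\<lambda>e::'v\<Rightarrow>real. [:a:]"] exI[of _ 0]) simp
next
  case (polyfun_var u)
  show ?case
  proof (cases "u = v")
    case True
    have "param_poly 1 (\<lambda>e::'v\<Rightarrow>real. [:0,1:])"
      by (auto simp: param_poly_def intro: polyfun_intros)
    with True have "param_poly 1 (\<lambda>e::'v\<Rightarrow>real. [:0,1:]) \<and> (\<forall>(e::'v\<Rightarrow>real) x. (e(v := x)) u = poly [:0,1:] x)" by simp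
    then show ?thesis by blast
  next
    case False
    have "(\<lambda>e. coeff [:e u:] i) \<in> polyfun" for i
      by (cases i) (auto intro: polyfun_intros)
    then have "param_poly 0 (\<lambda>e. [:e u:])" by (auto simp: param_poly_def)
    with False have "param_poly 0 (\<lambda>e. [:e u:]) \<and> (\<forall>e x. (e(v := x)) u = poly [:e u:] x)" by simp
    then show ?thesis by blast
  qed
next
  case (polyfun_add f g)
  then obtain c d c' d' where "param_poly d c" "\<forall>e x. f (e(v := x)) = poly (c e) x"
    "param_poly d' c'" "\<forall>e x. g (e(v := x)) = poly (c' e) x" by blast
  moreover from this have "param_poly (max d d') (\<lambda>e. c e + c' e)"
    by (auto simp: param_poly_def intro!: polyfun_intros degree_add_le intro: le_max_iff_disj[THEN iffD2])
  ultimately have "param_poly (max d d') (\<lambda>e. c e + c' e) \<and> (\<forall>e x. f (e(v := x)) + g (e(v := x)) = poly (c e + c' e) x)"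
    by simp
  then show ?case by blast
next
  case (polyfun_mult f g)
  then obtain c d c' d' where *: "param_poly d c" "\<forall>e x. f (e(v := x)) = poly (c e) x"
    "param_poly d' c'" "\<forall>e x. g (e(v := x)) = poly (c' e) x" by blast
  have "degree (c e * c' e) \<le> d + d'" for e
    using * degree_mult_le[of "c e" "c' e"] unfolding param_poly_def by (meson add_mono order_trans)
  with * have "param_poly (d + d') (\<lambda>e. c e * c' e)"
    by (auto simp: param_poly_def coeff_mult intro!: polyfun_intros)
  with * have "param_poly (d + d') (\<lambda>e. c e * c' e) \<and> (\<forall>e x. f (e(v := x)) * g (e(v := x)) = poly (c e * c' e) x)"
    by simp
  then show ?case by blast
qed

section \<open>Transporting sign patterns between parameter values\<close>

definition same_signs :: "(('v \<Rightarrow> real) \<Rightarrow> real) set \<Rightarrow> ('v \<Rightarrow> real) \<Rightarrow> ('v \<Rightarrow> real) \<Rightarrow> bool" where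
  "same_signs Q e e' \<longleftrightarrow> (\<forall>q\<in>Q. sgn (q e) = sgn (q e'))"

text \<open>Encodes that the joint sign vectors of the family, met from left to right, form the same
  sequence at \<open>e\<close> and \<open>e'\<close>. The reparametrisation \<open>\<phi>\<close>
  replaces a list of these vectors and is directly what moves a witness from one parameter value to
  the other.\<close>

definition sgn_matched :: "(('v \<Rightarrow> real) \<Rightarrow> real poly) set \<Rightarrow> ('v \<Rightarrow> real) \<Rightarrow> ('v \<Rightarrow> real) \<Rightarrow> bool" where
  "sgn_matched C e e' \<longleftrightarrow> (\<exists>\<phi>. strict_mono \<phi> \<and> surj \<phi> \<and>
     (\<forall>c\<in>C. \<forall>x. sgn (poly (c e) x) = sgn (poly (c e') (\<phi> x))))"

definition sgn_controlled :: "(('v \<Rightarrow> real) \<Rightarrow> real poly) set \<Rightarrow> bool" where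
  "sgn_controlled C \<longleftrightarrow>
     (\<exists>Q. finite Q \<and> Q \<subseteq> polyfun \<and> (\<forall>e e'. same_signs Q e e' \<longrightarrow> sgn_matched C e e'))"

text \<open>One step of polynomial division, scaled so that it makes sense for parametric coefficients.
  At a root of \<open>q\<close> its sign is that of \<open>c\<close> times that of the leading coefficient of \<open>q\<close>.\<close>

definition division_step :: "(('v \<Rightarrow> real) \<Rightarrow> real poly) \<Rightarrow> nat \<Rightarrow> (('v \<Rightarrow> real) \<Rightarrow> real poly) \<Rightarrow> nat
    \<Rightarrow> ('v \<Rightarrow> real) \<Rightarrow> real poly" where
  "division_step c d q k e = smult (coeff (q e) k) (c e) - smult (coeff (c e) d) (monom 1 (d - k) * q e)"

lemma param_poly_division_step:
  assumes "param_poly d c" "param_poly k q" "k \<le> d" "d > 0"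
  shows "param_poly (d - 1) (division_step c d q k)"
proof -
  have 1: "(\<lambda>e. coeff (c e) i) \<in> polyfun" "(\<lambda>e. coeff (q e) i) \<in> polyfun" for i
    using assms by (auto simp: param_poly_def)
  have "(\<lambda>e. coeff (monom 1 (d - k) * q e) i) \<in> polyfun" for i
    by (cases "i < d - k") (auto simp: coeff_monom_mult not_less intro: polyfun_const 1)
  then have "(\<lambda>e. coeff (division_step c d q k e) i) \<in> polyfun" for i
    unfolding division_step_def coeff_diff coeff_smult
    by (intro polyfun_intros 1)
  moreover have "degree (division_step c d q k e) \<le> d - 1" for e
  proof (rule degree_le, intro allI impI)
    fix i assume "d - 1 < i"
    then consider "i = d" | "i > d" using assms(4) by linarith
    then show "coeff (division_step c d q k e) i = 0"
    proof cases
      case 1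
      then show ?thesis using assms(3) by (simp add: division_step_def coeff_monom_mult)
    next
      case 2
      have "degree (c e) < i" "degree (q e) < i - (d - k)"
        using assms 2 unfolding param_poly_def by (auto intro: le_less_trans)
      then show ?thesis using 2 by (simp add: division_step_def coeff_monom_mult coeff_eq_0)
    qed
  qed
  ultimately show ?thesis by (simp add: param_poly_def)
qed

lemma param_poly_pderiv:
  assumes "param_poly d c"
  shows "param_poly (d - 1) (\<lambda>e. pderiv (c e))"
proof -
  have "(\<lambda>e. of_nat (Suc i) * coeff (c e) (Suc i)) \<in> polyfun" for i
    using assms unfolding param_poly_def by (intro polyfun_mult polyfun_const) blast
  then show ?thesis
    using assms unfolding param_poly_def coeff_pderiv degree_pderiv by (auto intro: diff_le_mono)
qed

definition truncate_poly :: "nat \<Rightarrow> (('v \<Rightarrow> real) \<Rightarrow> real poly) \<Rightarrow> ('v \<Rightarrow> real) \<Rightarrow> real poly" where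
  "truncate_poly d c e = c e - monom (coeff (c e) d) d"

lemma param_poly_truncate:
  assumes "param_poly d c" "d > 0"
  shows "param_poly (d - 1) (truncate_poly d c)"
proof -
  have "degree (truncate_poly d c e) \<le> d - 1" for e
  proof (rule degree_le, intro allI impI)
    fix i assume "d - 1 < i"
    then have "i \<ge> d" by simp
    moreover have "coeff (c e) i = 0" if "i > d"
      using that assms unfolding param_poly_def by (meson coeff_eq_0 le_less_trans)
    ultimately show "coeff (truncate_poly d c e) i = 0"
      by (auto simp: truncate_poly_def le_less)
  qed
  moreover have "(\<lambda>e. coeff (truncate_poly d c e) i) \<in> polyfun" for i
    using assms by (cases "i = d") (auto simp: truncate_poly_def param_poly_def intro!: polyfun_intros)
  ultimately show ?thesis by (simp add: param_poly_def)
qed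

text \<open>Induction on the multiset of degrees. If some leading coefficient vanishes, that polynomial is
  truncated. Otherwise a polynomial \<open>c\<close> of maximal degree is replaced by its derivative and by the
  division steps of \<open>c\<close> by all the others: these determine the signs of \<open>c\<close> at the roots
  of the others, between which \<open>c\<close> is monotone.\<close>

lemma sgn_controlled_list:
  fixes xs :: "((('v \<Rightarrow> real) \<Rightarrow> real poly) \<times> nat) list"
  assumes "\<forall>(c, d)\<in>set xs. param_poly d c"
  shows "sgn_controlled (fst ` set xs)"
  using wf_inv_image[OF wf_mult[OF wf_less_than], of "\<lambda>xs. mset (map snd xs)"] assms
proof (induction xs rule: wf_induct_rule)
  case (less xs)
  \<comment> \<open>The decrease in the multiset order: one entry of formal degree \<open>d\<close>
    leaves, and any number of entries of smaller formal degrees, collected in \<open>K\<close>, come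
    in.\<close>
  have IH: "sgn_controlled (fst ` set ys)"
    if "\<forall>(c, d)\<in>set ys. param_poly d c" "(c, d) \<in> set xs"
      "mset (map snd ys) = mset (map snd (remove1 (c, d) xs)) + K" "\<forall>k\<in>#K. k < d"
    for ys :: "((('v \<Rightarrow> real) \<Rightarrow> real poly) \<times> nat) list" and c d K
  proof -
    have "mset (map snd xs) = mset (map snd (remove1 (c, d) xs)) + {#d#}"
    proof -
      have "mset xs = add_mset (c, d) (mset (remove1 (c, d) xs))" using that(2) by simp
      then have "image_mset snd (mset xs) = image_mset snd (add_mset (c, d) (mset (remove1 (c, d) xs)))"
        by (rule arg_cong)
      then show ?thesis by (simp only: mset_map image_mset_add_mset snd_conv add_mset_add_single[symmetric])
    qed
    moreover have "(mset (map snd (remove1 (c, d) xs)) + K, mset (map snd (remove1 (c, d) xs)) + {#d#}) \<in> mult less_than"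
      using that(4) by (intro one_step_implies_mult) auto
    ultimately have "(ys, xs) \<in> inv_image (mult less_than) (\<lambda>xs. mset (map snd xs))"
      using that(3) by simp
    then show ?thesis using less.IH that(1) by blast
  qed
  have rem: "set xs \<subseteq> insert x (set (remove1 x xs))" for x by (metis in_set_remove1 insert_iff subsetI)
  have rem': "set (remove1 x xs) \<subseteq> set xs" for x by (rule set_remove1_subset)
  consider "xs = []" | c where "(c, 0) \<in> set xs" | "xs \<noteq> []" "\<forall>(c,d)\<in>set xs. d > 0"
    by (metis (mono_tags, lifting) case_prodI2 gr0I)
  then show ?case
  proof cases
    case 1
    then show ?thesis
      by (auto simp: sgn_controlled_def sgn_matched_def strict_mono_def intro!: exI[of _ "{}"] exI[of _ id])
  next
    case 2
    then have "sgn_controlled (fst ` set (remove1 (c, 0) xs))"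
      using less.prems rem' by (intro IH[of _ c 0 "{#}"]) auto
    then obtain Q where Q: "finite Q" "Q \<subseteq> polyfun"
      "\<And>e e'. same_signs Q e e' \<Longrightarrow> sgn_matched (fst ` set (remove1 (c, 0) xs)) e e'"
      unfolding sgn_controlled_def by blast
    have c: "param_poly 0 c" using less.prems 2 by auto
    have const: "poly (c e) x = coeff (c e) 0" for e x
    proof -
      have "degree (c e) = 0" using c by (simp add: param_poly_def)
      then obtain a where "c e = [:a:]" by (rule degree_eq_zeroE)
      then show ?thesis by simp
    qed
    let ?Q = "insert (\<lambda>e. coeff (c e) 0) Q"
    have "sgn_matched (fst ` set xs) e e'" if "same_signs ?Q e e'" for e e'
    proof -
      have "same_signs Q e e'" using that by (simp add: same_signs_def)
      from Q(3)[OF this] obtain \<phi> where \<phi>: "strict_mono \<phi>" "surj \<phi>"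
        "\<forall>c\<in>fst ` set (remove1 (c, 0) xs). \<forall>x. sgn (poly (c e) x) = sgn (poly (c e') (\<phi> x))"
        unfolding sgn_matched_def by blast
      moreover have "sgn (poly (c e) x) = sgn (poly (c e') (\<phi> x))" for x
        using that by (simp add: const same_signs_def)
      ultimately have "\<forall>c\<in>fst ` set xs. \<forall>x. sgn (poly (c e) x) = sgn (poly (c e') (\<phi> x))"
        using rem[of "(c,0)"] by fastforce
      then show ?thesis using \<phi> by (auto simp: sgn_matched_def)
    qed
    moreover have "finite ?Q" "?Q \<subseteq> polyfun" using Q c by (auto simp: param_poly_def)
    ultimately show ?thesis unfolding sgn_controlled_def by blast
  next
    case 3
    have pp: "param_poly d c" "d > 0" if "(c, d) \<in> set xs" for c d using 3 less.prems that by auto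
    \<comment> \<open>Which leading coefficient vanishes depends on \<open>e\<close>, so the
      truncated families are prepared in advance, one for each entry.\<close>
    define trunc where "trunc = (\<lambda>(c, d). (truncate_poly d c, d - 1) # remove1 (c, d) xs)"
    have "sgn_controlled (fst ` set (trunc x))" if "x \<in> set xs" for x
    proof -
      obtain c d where x: "x = (c, d)" by fastforce
      show ?thesis unfolding x trunc_def
        using that x pp[of c d] less.prems rem'[of x] param_poly_truncate[of d c]
        by (intro IH[of _ c d "{#d - 1#}"]) auto
    qed
    then have "\<forall>x\<in>set xs. \<exists>Q. finite Q \<and> Q \<subseteq> polyfun \<and>
        (\<forall>e e'. same_signs Q e e' \<longrightarrow> sgn_matched (fst ` set (trunc x)) e e')"
      unfolding sgn_controlled_def by blast
    then obtain QA where QA': "\<forall>x\<in>set xs. finite (QA x) \<and> QA x \<subseteq> polyfun \<and>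
        (\<forall>e e'. same_signs (QA x) e e' \<longrightarrow> sgn_matched (fst ` set (trunc x)) e e')"
      by (rule bchoice[THEN exE])
    then have QA: "finite (QA x)" "QA x \<subseteq> polyfun"
      "\<And>e e'. same_signs (QA x) e e' \<Longrightarrow> sgn_matched (fst ` set (trunc x)) e e'" if "x \<in> set xs" for x
      using that by blast+
    \<comment> \<open>Maximality of \<open>d\<close> makes every other entry, as well as the
      derivative, an admissible divisor of \<open>c\<close>.\<close>
    obtain c d where cd: "(c, d) \<in> set xs" and dmax: "\<And>q k. (q, k) \<in> set xs \<Longrightarrow> k \<le> d"
    proof -
      have "Max (snd ` set xs) \<in> snd ` set xs" using 3 by (intro Max_in) auto
      then obtain c where "(c, Max (snd ` set xs)) \<in> set xs" by auto
      moreover have "k \<le> Max (snd ` set xs)" if "(q, k) \<in> set xs" for q k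
        using that by (intro Max_ge) force+
      ultimately show ?thesis using that by blast
    qed
    define ys where "ys = (\<lambda>e. pderiv (c e), d - 1) # remove1 (c, d) xs"
    define zs where "zs = ys @ map (\<lambda>(q, k). (division_step c d q k, d - 1)) ys"
    have ys: "param_poly k q \<and> k \<le> d" if "(q, k) \<in> set ys" for q k
      using that pp cd dmax param_poly_pderiv[OF pp(1)[OF cd]] rem'[of "(c,d)"] unfolding ys_def by auto
    have "sgn_controlled (fst ` set zs)"
    proof (rule IH[OF _ cd])
      show "\<forall>(c, d)\<in>set zs. param_poly d c"
        using ys param_poly_division_step[OF pp(1)[OF cd] _ _ pp(2)[OF cd]] unfolding zs_def by auto
      show "mset (map snd zs) = mset (map snd (remove1 (c, d) xs)) + ({#d - 1#} + image_mset (\<lambda>_. d - 1) (mset ys))"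
        unfolding zs_def by (simp add: ys_def case_prod_unfold image_mset.compositionality comp_def)
      show "\<forall>k\<in>#{#d - 1#} + image_mset (\<lambda>_. d - 1) (mset ys). k < d"
        using pp(2)[OF cd] by auto
    qed
    then obtain QB where QB: "finite QB" "QB \<subseteq> polyfun"
      "\<And>e e'. same_signs QB e e' \<Longrightarrow> sgn_matched (fst ` set zs) e e'"
      unfolding sgn_controlled_def by metis
    \<comment> \<open>One finite set must serve all \<open>e\<close>: the signs of the leading
      coefficients tell which case applies, \<open>QA\<close> settles the truncated families, and
      \<open>QB\<close> the family with \<open>c\<close> replaced by its derivative and
      remainders.\<close>
    define Q where "Q = (\<lambda>(q, k) e. coeff (q e) k) ` set xs \<union> QB \<union> (\<Union>x\<in>set xs. QA x)"
    have "finite Q" using QA(1) QB(1) unfolding Q_def by blast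
    moreover have "(\<lambda>(q, k) e. coeff (q e) k) ` set xs \<subseteq> polyfun"
      using pp(1) by (auto simp: param_poly_def)
    then have "Q \<subseteq> polyfun"
      unfolding Q_def using QA(2) QB(2) by (intro Un_least UN_least) blast+
    moreover have "sgn_matched (fst ` set xs) e e'" if "same_signs Q e e'" for e e'
    proof -
      have lc: "sgn (coeff (q e) k) = sgn (coeff (q e') k)" if "(q, k) \<in> set xs" for q k
      proof -
        have "(\<lambda>(q, k) e. coeff (q e) k) (q, k) \<in> Q" unfolding Q_def using that by blast
        then show ?thesis using \<open>same_signs Q e e'\<close> unfolding same_signs_def by auto
      qed
      show ?thesis
      proof (cases "\<exists>(q, k)\<in>set xs. coeff (q e) k = 0")
        case True
        then obtain q k where qk: "(q, k) \<in> set xs" "coeff (q e) k = 0" by auto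
        then have "coeff (q e') k = 0" using lc by (metis sgn_0 sgn_zero_iff)
        then have tr: "truncate_poly k q e = q e" "truncate_poly k q e' = q e'"
          using qk by (auto simp: truncate_poly_def)
        have "same_signs (QA (q, k)) e e'"
          using \<open>same_signs Q e e'\<close> qk(1) unfolding same_signs_def Q_def by blast
        then obtain \<phi> where \<phi>: "strict_mono \<phi>" "surj \<phi>"
          "\<forall>c\<in>fst ` set (trunc (q, k)). \<forall>x. sgn (poly (c e) x) = sgn (poly (c e') (\<phi> x))"
          using QA(3)[OF qk(1)] unfolding sgn_matched_def by blast
        have "sgn (poly (q e) x) = sgn (poly (q e') (\<phi> x))" for x
          using \<phi>(3) tr unfolding trunc_def by auto
        moreover have "\<forall>c\<in>fst ` set (remove1 (q, k) xs). \<forall>x. sgn (poly (c e) x) = sgn (poly (c e') (\<phi> x))"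
          using \<phi>(3) unfolding trunc_def by auto
        ultimately have "\<forall>c\<in>fst ` set xs. \<forall>x. sgn (poly (c e) x) = sgn (poly (c e') (\<phi> x))"
          using rem[of "(q, k)"] by fastforce
        then show ?thesis using \<phi> by (auto simp: sgn_matched_def)
      next
        case False
        then have nz: "coeff (q e) k \<noteq> 0" if "(q, k) \<in> set xs" for q k using that by auto
        have "same_signs QB e e'" using \<open>same_signs Q e e'\<close> unfolding same_signs_def Q_def by blast
        then obtain \<phi> where \<phi>: "strict_mono \<phi>" "surj \<phi>"
          "\<forall>c\<in>fst ` set zs. \<forall>x. sgn (poly (c e) x) = sgn (poly (c e') (\<phi> x))"
          using QB(3) unfolding sgn_matched_def by blast
        have lcy: "sgn (coeff (q e) k) = sgn (coeff (q e') k) \<and> coeff (q e) k \<noteq> 0" if "(q, k) \<in> set ys" for q k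
        proof (cases "(q, k) \<in> set (remove1 (c, d) xs)")
          case True
          then show ?thesis using nz lc rem' by blast
        next
          case False
          then have "q = (\<lambda>e. pderiv (c e))" "k = d - 1" using that unfolding ys_def by auto
          then show ?thesis using nz[OF cd] lc[OF cd] pp(2)[OF cd] by (simp add: coeff_pderiv sgn_mult)
        qed
        \<comment> \<open>Now the formal degree is the actual one at both parameter values, as the
          comparison of signs near infinity requires.\<close>
        have dg: "degree (c e) = d" "degree (c e') = d"
        proof -
          have "coeff (c e') d \<noteq> 0" using nz[OF cd] lc[OF cd] by (metis sgn_zero_iff)
          then show "degree (c e) = d" "degree (c e') = d"
            using nz[OF cd] pp(1)[OF cd] unfolding param_poly_def by (auto intro: antisym le_degree)
        qed
        have "\<exists>\<psi>. strict_mono \<psi> \<and> surj \<psi> \<and>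
          (\<forall>j\<in>set ys. \<forall>x. sgn (poly (fst j e) x) = sgn (poly (fst j e') (\<psi> x))) \<and>
          (\<forall>x. sgn (poly (c e) x) = sgn (poly (c e') (\<psi> x)))"
        proof (rule sgn_match_extend[OF _ _ \<phi>(1,2)])
          show "fst j e \<noteq> 0" if "j \<in> set ys" for j
            using lcy[of "fst j" "snd j"] that by (cases j) auto
          show "sgn (poly (fst j e) x) = sgn (poly (fst j e') (\<phi> x))" if "j \<in> set ys" for j x
            using \<phi>(3) that unfolding zs_def by auto
          show "(\<lambda>e. pderiv (c e), d - 1) \<in> set ys" by (simp add: ys_def)
          show "sgn (poly (c e) x) = sgn (poly (c e') (\<phi> x))"
            if j: "j \<in> set ys" and root: "poly (fst j e) x = 0" for j x
          proof -
            obtain q k where qk: "j = (q, k)" by fastforce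
            have mem: "(division_step c d q k, d - 1) \<in> set zs"
              using j unfolding zs_def qk by force
            have "sgn (poly (q e) x) = sgn (poly (q e') (\<phi> x))"
              using \<phi>(3) j unfolding zs_def qk by force
            then have root': "poly (q e') (\<phi> x) = 0" using root qk by (simp add: sgn_zero_iff)
            have "sgn (poly (division_step c d q k e) x) = sgn (poly (division_step c d q k e') (\<phi> x))"
              using \<phi>(3) mem by force
            moreover have "coeff (q e') k \<noteq> 0" using lcy[of q k] j qk by (metis sgn_zero_iff)
            ultimately show ?thesis using lcy[of q k] j root root' qk
              by (simp add: division_step_def sgn_mult sgn_zero_iff)
          qed
        qed (use dg lc[OF cd] in auto)
        then obtain \<psi> where \<psi>: "strict_mono \<psi>" "surj \<psi>"
          "\<forall>j\<in>set ys. \<forall>x. sgn (poly (fst j e) x) = sgn (poly (fst j e') (\<psi> x))"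
          "\<forall>x. sgn (poly (c e) x) = sgn (poly (c e') (\<psi> x))" by blast
        have "\<forall>c\<in>fst ` set xs. \<forall>x. sgn (poly (c e) x) = sgn (poly (c e') (\<psi> x))"
          using rem[of "(c, d)"] \<psi>(3,4) unfolding ys_def by fastforce
        then show ?thesis using \<psi> by (auto simp: sgn_matched_def)
      qed
    qed
    ultimately show ?thesis unfolding sgn_controlled_def by blast
  qed
qed

section \<open>Semialgebraic predicates and functions\<close>

text \<open>A predicate counts as semialgebraic when the signs of finitely many polynomials decide it. This is
  equivalent to being a Boolean combination of polynomial inequalities, but needs no syntax of formulas.\<close>

definition semialg :: "(('v \<Rightarrow> real) \<Rightarrow> bool) \<Rightarrow> bool" where
  "semialg P \<longleftrightarrow> (\<exists>Q. finite Q \<and> Q \<subseteq> polyfun \<and> (\<forall>e e'. same_signs Q e e' \<longrightarrow> P e = P e'))"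

lemma same_signs_Un: "same_signs (Q \<union> Q') e e' \<longleftrightarrow> same_signs Q e e' \<and> same_signs Q' e e'"
  by (auto simp: same_signs_def)

lemma semialg_not: "semialg P \<Longrightarrow> semialg (\<lambda>e. \<not> P e)"
  unfolding semialg_def by metis

lemma semialg_conj:
  assumes "semialg P" "semialg P'"
  shows "semialg (\<lambda>e. P e \<and> P' e)"
proof -
  obtain Q Q' where "finite Q" "Q \<subseteq> polyfun" "\<forall>e e'. same_signs Q e e' \<longrightarrow> P e = P e'"
    "finite Q'" "Q' \<subseteq> polyfun" "\<forall>e e'. same_signs Q' e e' \<longrightarrow> P' e = P' e'"
    using assms unfolding semialg_def by blast
  then show ?thesis unfolding semialg_def
    by (intro exI[of _ "Q \<union> Q'"]) (simp add: same_signs_Un, blast)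
qed

lemma semialg_compose:
  assumes "semialg P" "\<And>v. (\<lambda>e. \<sigma> e v) \<in> polyfun"
  shows "semialg (\<lambda>e. P (\<sigma> e))"
proof -
  obtain Q where "finite Q" "Q \<subseteq> polyfun" "\<forall>e e'. same_signs Q e e' \<longrightarrow> P e = P e'"
    using assms(1) unfolding semialg_def by blast
  moreover have "(\<lambda>q e. q (\<sigma> e)) ` Q \<subseteq> polyfun"
    using polyfun_compose[where \<sigma>=\<sigma>, OF _ assms(2)] \<open>Q \<subseteq> polyfun\<close> by auto
  moreover have "same_signs ((\<lambda>q e. q (\<sigma> e)) ` Q) e e' \<longleftrightarrow> same_signs Q (\<sigma> e) (\<sigma> e')" for e e'
    by (auto simp: same_signs_def)
  ultimately show ?thesis unfolding semialg_def
    by (intro exI[of _ "(\<lambda>q e. q (\<sigma> e)) ` Q"]) auto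
qed

text \<open>The Tarski-Seidenberg step. If the signs in \<open>Q'\<close> agree at \<open>e\<close>
  and \<open>e'\<close>, the matching turns each witness \<open>x\<close> at \<open>e\<close> into a
  witness \<open>\<phi> x\<close> at \<open>e'\<close>; since \<open>\<phi>\<close> is onto, every
  witness at \<open>e'\<close> arises in this way.\<close>

lemma semialg_ex_var:
  fixes P :: "('v \<Rightarrow> real) \<Rightarrow> bool"
  assumes "semialg P"
  shows "semialg (\<lambda>e. \<exists>x. P (e(v := x)))"
proof -
  obtain Q where Q: "finite Q" "Q \<subseteq> polyfun" "\<And>e e'. same_signs Q e e' \<Longrightarrow> P e = P e'"
    using assms unfolding semialg_def by blast
  have "\<forall>q\<in>Q. \<exists>cd. param_poly (snd cd) (fst cd) \<and> (\<forall>e x. q (e(v := x)) = poly (fst cd e) x)"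
    using polyfun_as_param_poly[of _ v] Q(2) by fastforce
  then obtain cd where cd: "\<forall>q\<in>Q. param_poly (snd (cd q)) (fst (cd q)) \<and>
      (\<forall>e x. q (e(v := x)) = poly (fst (cd q) e) x)" by (rule bchoice[THEN exE])
  obtain qs where qs: "set qs = Q" using finite_list[OF Q(1)] by blast
  have "sgn_controlled (fst ` set (map cd qs))"
    using cd qs by (intro sgn_controlled_list) (auto simp: case_prod_unfold)
  then obtain Q' where Q': "finite Q'" "Q' \<subseteq> polyfun"
    "\<And>e e'. same_signs Q' e e' \<Longrightarrow> sgn_matched (fst ` cd ` Q) e e'"
    unfolding sgn_controlled_def using qs by auto
  have "(\<exists>x. P (e(v := x))) = (\<exists>x. P (e'(v := x)))" if sm: "same_signs Q' e e'" for e e'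
  proof -
    obtain \<phi> where \<phi>: "surj \<phi>"
      "\<forall>c\<in>fst ` cd ` Q. \<forall>x. sgn (poly (c e) x) = sgn (poly (c e') (\<phi> x))"
      using Q'(3)[OF sm] unfolding sgn_matched_def by blast
    have "P (e(v := x)) = P (e'(v := \<phi> x))" for x
    proof (rule Q(3), unfold same_signs_def, intro ballI)
      fix q assume "q \<in> Q"
      then show "sgn (q (e(v := x))) = sgn (q (e'(v := \<phi> x)))" using \<phi>(2) cd by auto
    qed
    then show ?thesis using \<phi>(1) by (metis surjD)
  qed
  then show ?thesis unfolding semialg_def using Q' by blast
qed

lemma semialg_ex_finite:
  assumes "finite V" "semialg P"
  shows "semialg (\<lambda>e. \<exists>f. P (\<lambda>v. if v \<in> V then f v else e v))"
  using assms(1)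
proof (induction V rule: finite_induct)
  case empty
  then show ?case using assms(2) by simp
next
  case (insert u V)
  have "(\<exists>f. P (\<lambda>v. if v \<in> insert u V then f v else e v)) \<longleftrightarrow>
      (\<exists>x f. P (\<lambda>v. if v \<in> V then f v else (e(u := x)) v))" for e
  proof
    assume "\<exists>f. P (\<lambda>v. if v \<in> insert u V then f v else e v)"
    then obtain f where "P (\<lambda>v. if v \<in> insert u V then f v else e v)" by blast
    moreover have "(\<lambda>v. if v \<in> insert u V then f v else e v) = (\<lambda>v. if v \<in> V then f v else (e(u := f u)) v)"
      by auto
    ultimately show "\<exists>x f. P (\<lambda>v. if v \<in> V then f v else (e(u := x)) v)" by metis
  next
    assume "\<exists>x f. P (\<lambda>v. if v \<in> V then f v else (e(u := x)) v)"
    then obtain x f where "P (\<lambda>v. if v \<in> V then f v else (e(u := x)) v)" by blast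
    moreover have "(\<lambda>v. if v \<in> V then f v else (e(u := x)) v) =
        (\<lambda>v. if v \<in> insert u V then (f(u := x)) v else e v)"
      using insert.hyps by auto
    ultimately show "\<exists>f. P (\<lambda>v. if v \<in> insert u V then f v else e v)" by metis
  qed
  then show ?case using semialg_ex_var[OF insert.IH, of u] by simp
qed

text \<open>Quantifies over a whole vector at once: \<open>Inl\<close> indexes its coordinates,
  \<open>Inr\<close> the remaining variables.\<close>

theorem semialg_ex:
  fixes P :: "('a::finite \<Rightarrow> real) \<Rightarrow> ('b \<Rightarrow> real) \<Rightarrow> bool"
  assumes "semialg (\<lambda>e. P (\<lambda>a. e (Inl a)) (\<lambda>b. e (Inr b)))"
  shows "semialg (\<lambda>e. \<exists>x. P x e)"
proof -
  have "semialg (\<lambda>e. \<exists>f. P (\<lambda>a. if Inl a \<in> range Inl then f (Inl a) else e (Inl a))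
      (\<lambda>b::'b. if Inr b \<in> range (Inl :: 'a \<Rightarrow> 'a + 'b) then f (Inr b) else e (Inr b)))"
    using semialg_ex_finite[OF _ assms, of "range Inl"] by simp
  then have "semialg (\<lambda>e::'a + 'b \<Rightarrow> real. \<exists>f::'a + 'b \<Rightarrow> real. P (\<lambda>a. f (Inl a)) (\<lambda>b. e (Inr b)))"
    by (simp add: image_iff)
  moreover have "(\<exists>f::'a + 'b \<Rightarrow> real. P (\<lambda>a. f (Inl a)) e) \<longleftrightarrow> (\<exists>x. P x e)" for e
  proof
    assume "\<exists>x. P x e"
    then obtain x where "P x e" by blast
    then show "\<exists>f::'a + 'b \<Rightarrow> real. P (\<lambda>a. f (Inl a)) e"
      by (intro exI[of _ "case_sum x (\<lambda>_. 0)"]) simp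
  qed blast
  ultimately have *: "semialg (\<lambda>e::'a + 'b \<Rightarrow> real. \<exists>x. P x (\<lambda>b. e (Inr b)))" by simp
  \<comment> \<open>The predicate no longer depends on the \<open>Inl\<close> variables; putting 0
    for them gives one over \<open>'b\<close> alone.\<close>
  have "(\<lambda>e::'b\<Rightarrow>real. (case_sum (\<lambda>_. 0) e) v) \<in> polyfun" for v :: "'a + 'b"
    by (cases v) (auto intro: polyfun_const polyfun_var)
  from semialg_compose[where \<sigma> = "\<lambda>e. case_sum (\<lambda>_. 0) e", OF * this] show ?thesis by simp
qed

text \<open>Piecewise rational functions: on each sign class of \<open>Q\<close> a single quotient
  from the finite set \<open>D\<close> represents \<open>g\<close>. This is narrower than having a
  semialgebraic graph, but closure under sums and products becomes plain arithmetic without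
  quantifiers, and a positive denominator lets the sign of \<open>g\<close> be read off the
  numerator.\<close>

definition semialg_fun :: "(('v \<Rightarrow> real) \<Rightarrow> real) \<Rightarrow> bool" where
  "semialg_fun g \<longleftrightarrow> (\<exists>Q D. finite Q \<and> Q \<subseteq> polyfun \<and> finite D \<and> D \<subseteq> polyfun \<times> polyfun \<and>
     (\<forall>e0. \<exists>(p, q)\<in>D. \<forall>e. same_signs Q e e0 \<longrightarrow> q e > 0 \<and> g e = p e / q e))"

lemma semialg_fun_polyfun: "f \<in> polyfun \<Longrightarrow> semialg_fun f"
  unfolding semialg_fun_def
  by (rule exI[of _ "{}"], rule exI[of _ "{(f, \<lambda>_. 1)}"]) (simp add: polyfun_const)

lemma semialg_fun_if:
  assumes "semialg P" "semialg_fun g" "semialg_fun h"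
  shows "semialg_fun (\<lambda>e. if P e then g e else h e)"
proof -
  obtain Q1 D1 where 1: "finite Q1" "Q1 \<subseteq> polyfun" "finite D1" "D1 \<subseteq> polyfun \<times> polyfun"
    "\<And>e0. \<exists>(p, q)\<in>D1. \<forall>e. same_signs Q1 e e0 \<longrightarrow> q e > 0 \<and> g e = p e / q e"
    using assms(2) unfolding semialg_fun_def by blast
  obtain Q2 D2 where 2: "finite Q2" "Q2 \<subseteq> polyfun" "finite D2" "D2 \<subseteq> polyfun \<times> polyfun"
    "\<And>e0. \<exists>(p, q)\<in>D2. \<forall>e. same_signs Q2 e e0 \<longrightarrow> q e > 0 \<and> h e = p e / q e"
    using assms(3) unfolding semialg_fun_def by blast
  obtain Q3 where 3: "finite Q3" "Q3 \<subseteq> polyfun" "\<And>e e'. same_signs Q3 e e' \<Longrightarrow> P e = P e'"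
    using assms(1) unfolding semialg_def by blast
  let ?Q = "Q1 \<union> Q2 \<union> Q3" and ?D = "D1 \<union> D2"
  have "\<exists>(p, q)\<in>?D. \<forall>e. same_signs ?Q e e0 \<longrightarrow> q e > 0 \<and> (if P e then g e else h e) = p e / q e" for e0
  proof (cases "P e0")
    case True
    then have "P e" if "same_signs ?Q e e0" for e using 3(3) that by (auto simp: same_signs_Un)
    moreover obtain p q where "(p, q) \<in> D1" "\<And>e. same_signs Q1 e e0 \<Longrightarrow> q e > 0 \<and> g e = p e / q e"
      using 1(5)[of e0] by auto
    ultimately show ?thesis by (intro bexI[of _ "(p, q)"]) (auto simp: same_signs_Un)
  next
    case False
    then have "\<not> P e" if "same_signs ?Q e e0" for e using 3(3) that by (auto simp: same_signs_Un)
    moreover obtain p q where "(p, q) \<in> D2" "\<And>e. same_signs Q2 e e0 \<Longrightarrow> q e > 0 \<and> h e = p e / q e"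
      using 2(5)[of e0] by auto
    ultimately show ?thesis by (intro bexI[of _ "(p, q)"]) (auto simp: same_signs_Un)
  qed
  moreover have "finite ?Q" "?Q \<subseteq> polyfun" "finite ?D" "?D \<subseteq> polyfun \<times> polyfun" using 1 2 3 by auto
  ultimately show ?thesis unfolding semialg_fun_def
    by (intro exI[of _ ?Q] exI[of _ ?D] conjI allI)
qed

lemma semialg_fun_binop:
  fixes g h :: "('v \<Rightarrow> real) \<Rightarrow> real"
  assumes "semialg_fun g" "semialg_fun h"
    and N: "\<And>p q r s :: ('v \<Rightarrow> real) \<Rightarrow> real. p \<in> polyfun \<Longrightarrow> q \<in> polyfun \<Longrightarrow> r \<in> polyfun \<Longrightarrow> s \<in> polyfun \<Longrightarrow>
      (\<lambda>e. N (p e) (q e) (r e) (s e)) \<in> polyfun"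
    and f: "\<And>p q r s. 0 < q \<Longrightarrow> 0 < s \<Longrightarrow> f (p / q) (r / s) = N p q r s / (q * s)"
  shows "semialg_fun (\<lambda>e. f (g e) (h e))"
proof -
  obtain Q1 D1 where 1: "finite Q1" "Q1 \<subseteq> polyfun" "finite D1" "D1 \<subseteq> polyfun \<times> polyfun"
    "\<And>e0. \<exists>(p, q)\<in>D1. \<forall>e. same_signs Q1 e e0 \<longrightarrow> q e > 0 \<and> g e = p e / q e"
    using assms(1) unfolding semialg_fun_def by blast
  obtain Q2 D2 where 2: "finite Q2" "Q2 \<subseteq> polyfun" "finite D2" "D2 \<subseteq> polyfun \<times> polyfun"
    "\<And>e0. \<exists>(p, q)\<in>D2. \<forall>e. same_signs Q2 e e0 \<longrightarrow> q e > 0 \<and> h e = p e / q e"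
    using assms(2) unfolding semialg_fun_def by blast
  define w where "w = (\<lambda>((p, q), (r, s)). (\<lambda>e::'v\<Rightarrow>real. N (p e) (q e) (r e) (s e), \<lambda>e. q e * s e))"
  let ?Q = "Q1 \<union> Q2" and ?D = "w ` (D1 \<times> D2)"
  have "\<exists>(u, v)\<in>?D. \<forall>e. same_signs ?Q e e0 \<longrightarrow> v e > 0 \<and> f (g e) (h e) = u e / v e" for e0
  proof -
    obtain p q where pq: "(p, q) \<in> D1" "\<And>e. same_signs Q1 e e0 \<Longrightarrow> q e > 0 \<and> g e = p e / q e"
      using 1(5)[of e0] by auto
    obtain r s where rs: "(r, s) \<in> D2" "\<And>e. same_signs Q2 e e0 \<Longrightarrow> s e > 0 \<and> h e = r e / s e"
      using 2(5)[of e0] by auto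
    have "q e * s e > 0 \<and> f (g e) (h e) = N (p e) (q e) (r e) (s e) / (q e * s e)" if "same_signs ?Q e e0" for e
      using pq(2)[of e] rs(2)[of e] that f by (auto simp: same_signs_Un)
    moreover have "w ((p, q), (r, s)) \<in> ?D" using pq(1) rs(1) by blast
    ultimately show ?thesis by (intro bexI[of _ "w ((p, q), (r, s))"]) (auto simp: w_def)
  qed
  moreover have "?D \<subseteq> polyfun \<times> polyfun"
  proof
    fix x assume "x \<in> ?D"
    then obtain p q r s where "(p, q) \<in> D1" "(r, s) \<in> D2" and x: "x = w ((p, q), (r, s))" by auto
    then have pqrs: "p \<in> polyfun" "q \<in> polyfun" "r \<in> polyfun" "s \<in> polyfun" using 1(4) 2(4) by auto
    show "x \<in> polyfun \<times> polyfun"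
      using N[OF pqrs] polyfun_mult[OF pqrs(2,4)] unfolding x w_def by simp
  qed
  moreover have "finite ?Q" "?Q \<subseteq> polyfun" "finite ?D" using 1 2 by auto
  ultimately show ?thesis unfolding semialg_fun_def
    by (intro exI[of _ ?Q] exI[of _ ?D] conjI allI)
qed

lemma semialg_fun_add:
  assumes "semialg_fun g" "semialg_fun h"
  shows "semialg_fun (\<lambda>e. g e + h e)"
  by (rule semialg_fun_binop[OF assms, where N = "\<lambda>p q r s. p * s + r * q"])
    (intro polyfun_add polyfun_mult; assumption | simp add: add_frac_eq)+

lemma semialg_fun_mult:
  assumes "semialg_fun g" "semialg_fun h"
  shows "semialg_fun (\<lambda>e. g e * h e)"
  by (rule semialg_fun_binop[OF assms, where N = "\<lambda>p q r s. p * r"])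
    (intro polyfun_mult; assumption | simp)+

lemma semialg_fun_sum:
  "(\<And>i. i \<in> I \<Longrightarrow> semialg_fun (f i)) \<Longrightarrow> semialg_fun (\<lambda>e. \<Sum>i\<in>I. f i e)"
  by (induction I rule: infinite_finite_induct)
    (simp_all add: semialg_fun_polyfun[OF polyfun_const] semialg_fun_add)

lemma semialg_fun_power: "semialg_fun f \<Longrightarrow> semialg_fun (\<lambda>e. f e ^ n)"
  by (induction n) (simp_all add: semialg_fun_polyfun[OF polyfun_const] semialg_fun_mult)

lemma semialg_fun_diff:
  assumes "semialg_fun f" "semialg_fun g"
  shows "semialg_fun (\<lambda>e. f e - g e)"
  using semialg_fun_add[OF assms(1) semialg_fun_mult[OF semialg_fun_polyfun[OF polyfun_const[of "-1"]] assms(2)]]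
  by simp

text \<open>Writing the inverse as \<open>f / (f * f)\<close> gives a positive denominator for
  either sign of \<open>f\<close>. Where \<open>f\<close> vanishes the inverse is 0, hence the
  second pair.\<close>

lemma semialg_fun_inverse_polyfun:
  assumes "f \<in> polyfun"
  shows "semialg_fun (\<lambda>e. inverse (f e))"
  unfolding semialg_fun_def
proof (rule exI[of _ "{f}"], rule exI[of _ "{(f, \<lambda>e. f e * f e), (\<lambda>_. 0, \<lambda>_. 1)}"], intro conjI allI)
  fix e0
  show "\<exists>(p, q)\<in>{(f, \<lambda>e. f e * f e), (\<lambda>_. 0, \<lambda>_. 1)}.
      \<forall>e. same_signs {f} e e0 \<longrightarrow> 0 < q e \<and> inverse (f e) = p e / q e"
  proof (cases "f e0 = 0")
    case True
    then have "f e = 0" if "same_signs {f} e e0" for e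
      using that by (simp add: same_signs_def sgn_zero_iff)
    then show ?thesis by auto
  next
    case False
    then have "f e \<noteq> 0" if "same_signs {f} e e0" for e
      using that by (auto simp: same_signs_def sgn_zero_iff)
    then show ?thesis by (auto simp: field_simps zero_less_mult_iff)
  qed
qed (use assms in \<open>simp_all add: polyfun_mult polyfun_const\<close>)

lemma semialg_fun_pos:
  assumes "semialg_fun g"
  shows "semialg (\<lambda>e. g e > 0)"
proof -
  obtain Q D where D: "finite Q" "Q \<subseteq> polyfun" "finite D" "D \<subseteq> polyfun \<times> polyfun"
    "\<And>e0. \<exists>(p, q)\<in>D. \<forall>e. same_signs Q e e0 \<longrightarrow> q e > 0 \<and> g e = p e / q e"
    using assms unfolding semialg_fun_def by blast
  have "g e > 0 \<longleftrightarrow> g e' > 0" if s: "same_signs (Q \<union> fst ` D) e e'" for e e'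
  proof -
    obtain p q where pq: "(p, q) \<in> D" "\<And>e. same_signs Q e e' \<Longrightarrow> q e > 0 \<and> g e = p e / q e"
      using D(5)[of e'] by auto
    have "same_signs Q e e'" "same_signs Q e' e'" using s by (auto simp: same_signs_Un same_signs_def)
    moreover have "p \<in> fst ` D" using pq(1) by force
    then have "sgn (p e) = sgn (p e')" using s by (simp add: same_signs_def)
    then have "p e > 0 \<longleftrightarrow> p e' > 0" by (metis sgn_greater)
    ultimately show ?thesis using pq(2)[of e] pq(2)[of e'] by (simp add: zero_less_divide_iff)
  qed
  moreover have "finite (Q \<union> fst ` D)" "Q \<union> fst ` D \<subseteq> polyfun" using D by auto
  ultimately show ?thesis unfolding semialg_def by blast
qed

lemma semialg_fun_less:
  assumes "semialg_fun f" "semialg_fun g"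
  shows "semialg (\<lambda>e. f e < g e)"
  using semialg_fun_pos[OF semialg_fun_diff[OF assms(2,1)]] by simp

lemma semialg_fun_le:
  assumes "semialg_fun f" "semialg_fun g"
  shows "semialg (\<lambda>e. f e \<le> g e)"
  using semialg_not[OF semialg_fun_less[OF assms(2,1)]] by (simp add: not_less)

lemma semialg_fun_eq:
  assumes "semialg_fun f" "semialg_fun g"
  shows "semialg (\<lambda>e. f e = g e)"
proof -
  have "f e = g e \<longleftrightarrow> f e \<le> g e \<and> g e \<le> f e" for e by auto
  then show ?thesis
    using semialg_conj[OF semialg_fun_le[OF assms] semialg_fun_le[OF assms(2,1)]] by simp
qed

lemma semialg_fun_max:
  assumes "semialg_fun f" "semialg_fun g"
  shows "semialg_fun (\<lambda>e. max (f e) (g e))"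
  unfolding max_def by (intro semialg_fun_if semialg_fun_le assms)

section \<open>Semialgebraic selections have bounded variation\<close>

definition semialg_family :: "(real \<Rightarrow> real ^ 'n \<Rightarrow> bool) \<Rightarrow> bool" where
  "semialg_family A \<longleftrightarrow> semialg (\<lambda>e :: 'n option \<Rightarrow> real. A (e None) (\<chi> i. e (Some i)))"

lemma semialg_family_subst:
  fixes A :: "real \<Rightarrow> real ^ 'n \<Rightarrow> bool"
  assumes "semialg_family A" "s \<in> polyfun" "\<And>i. x i \<in> polyfun"
  shows "semialg (\<lambda>e. A (s e) (\<chi> i. x i e))"
proof -
  have "(\<lambda>e. case v of None \<Rightarrow> s e | Some i \<Rightarrow> x i e) \<in> polyfun" for v
    using assms(2,3) by (cases v) auto
  from semialg_compose[where \<sigma> = "\<lambda>e v. case v of None \<Rightarrow> s e | Some i \<Rightarrow> x i e",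
      OF assms(1)[unfolded semialg_family_def] this]
  show ?thesis by simp
qed

text \<open>The universal quantifier is a negated existential one, so quantifier elimination
  applies. Only the comparison of two values of \<open>h\<close> has to be semialgebraic: two norms
  can be compared through their squares, while a norm itself is in general not piecewise
  rational.\<close>

lemma semialg_family_minimisers:
  fixes A :: "real \<Rightarrow> real ^ 'n \<Rightarrow> bool"
  assumes A: "semialg_family A"
    and h: "semialg (\<lambda>e :: 'n + 'n \<Rightarrow> real. h (\<chi> i. e (Inl i)) \<le> h (\<chi> i. e (Inr i)))"
  shows "semialg_family (\<lambda>t x. A t x \<and> (\<forall>x'. A t x' \<longrightarrow> h x \<le> h x'))"
proof -
  have "semialg (\<lambda>e :: 'n + 'n option \<Rightarrow> real. A (e (Inr None)) (\<chi> i. e (Inl i)))"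
    by (rule semialg_family_subst[OF A]) (rule polyfun_var)+
  moreover have "(\<lambda>e. case v of Inl i \<Rightarrow> e (Inr (Some i)) | Inr i \<Rightarrow> e (Inl i)) \<in> polyfun"
    for v :: "'n + 'n" by (cases v) (auto intro: polyfun_var)
  from semialg_compose[where \<sigma> = "\<lambda>(e :: 'n + 'n option \<Rightarrow> real) v. case v of Inl i \<Rightarrow> e (Inr (Some i)) | Inr i \<Rightarrow> e (Inl i)",
      OF h this]
  have "semialg (\<lambda>e :: 'n + 'n option \<Rightarrow> real. h (\<chi> i. e (Inr (Some i))) \<le> h (\<chi> i. e (Inl i)))" by simp
  ultimately have "semialg (\<lambda>e :: 'n + 'n option \<Rightarrow> real. A (e (Inr None)) (\<chi> i. e (Inl i)) \<and>
      \<not> h (\<chi> i. e (Inr (Some i))) \<le> h (\<chi> i. e (Inl i)))"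
    by (intro semialg_conj semialg_not)
  then have "semialg (\<lambda>e :: 'n option \<Rightarrow> real. \<exists>f. A (e None) (\<chi> i. f i) \<and>
      \<not> h (\<chi> i. e (Some i)) \<le> h (\<chi> i. f i))"
    by (rule semialg_ex)
  then have "semialg (\<lambda>e :: 'n option \<Rightarrow> real. A (e None) (\<chi> i. e (Some i)) \<and> \<not> (\<exists>f. A (e None) (\<chi> i. f i) \<and>
      \<not> h (\<chi> i. e (Some i)) \<le> h (\<chi> i. f i)))"
    by (intro semialg_conj semialg_not A[unfolded semialg_family_def])
  moreover have "(\<exists>f. A t (\<chi> i. f i) \<and> \<not> h x \<le> h (\<chi> i. f i)) \<longleftrightarrow> (\<exists>x'. A t x' \<and> \<not> h x \<le> h x')" for t x
    by (metis vec_lambda_eta)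
  ultimately have "semialg (\<lambda>e :: 'n option \<Rightarrow> real. A (e None) (\<chi> i. e (Some i)) \<and>
      \<not> (\<exists>x'. A (e None) x' \<and> \<not> h (\<chi> i. e (Some i)) \<le> h x'))"
    by (simp only:)
  then show ?thesis unfolding semialg_family_def by simp
qed

lemma compact_minimisers:
  fixes h :: "'a::heine_borel \<Rightarrow> real"
  assumes "compact K" "K \<noteq> {}" "continuous_on UNIV h"
  shows "compact {x\<in>K. \<forall>x'\<in>K. h x \<le> h x'} \<and> {x\<in>K. \<forall>x'\<in>K. h x \<le> h x'} \<noteq> {}"
proof -
  obtain x0 where x0: "x0 \<in> K" "\<forall>x\<in>K. h x0 \<le> h x"
    using continuous_attains_inf[OF assms(1,2) continuous_on_subset[OF assms(3)]] by auto
  have "{x\<in>K. \<forall>x'\<in>K. h x \<le> h x'} = K \<inter> {x. h x \<le> h x0}" using x0 by fastforce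
  moreover have "closed {x. h x \<le> h x0}" using assms(3) by (intro closed_Collect_le) auto
  ultimately show ?thesis using assms(1) x0 by (auto intro: compact_Int_closed)
qed

text \<open>The selected point is the lexicographic minimum.\<close>

lemma semialg_family_selection:
  fixes A :: "real \<Rightarrow> real ^ 'n \<Rightarrow> bool"
  assumes "semialg_family A" "\<And>t. t \<in> I \<Longrightarrow> compact {x. A t x} \<and> {x. A t x} \<noteq> {}"
  shows "\<exists>B. semialg_family B \<and> (\<forall>t x. B t x \<longrightarrow> A t x) \<and> (\<forall>t\<in>I. \<exists>!x. B t x)"
proof -
  have "\<exists>B. semialg_family B \<and> (\<forall>t x. B t x \<longrightarrow> A t x) \<and> (\<forall>t\<in>I. \<exists>x. B t x) \<and>
      (\<forall>t x x'. B t x \<longrightarrow> B t x' \<longrightarrow> (\<forall>i\<in>set is. x $ i = x' $ i))" for "is" :: "'n list"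
    using assms
  proof (induction "is" arbitrary: A)
    case Nil
    have "\<forall>t\<in>I. \<exists>x. A t x" using Nil.prems(2) by blast
    then show ?case using Nil.prems(1) by (intro exI[of _ A]) simp
  next
    case (Cons i "is")
    define A' where "A' t x \<longleftrightarrow> A t x \<and> (\<forall>x'. A t x' \<longrightarrow> x $ i \<le> x' $ i)" for t x
    have "semialg (\<lambda>e :: 'n + 'n \<Rightarrow> real. e (Inl i) \<le> e (Inr i))"
      by (intro semialg_fun_le semialg_fun_polyfun polyfun_var)
    then have "semialg_family A'"
      unfolding A'_def by (intro semialg_family_minimisers Cons.prems(1)) simp
    moreover have "compact {x. A' t x} \<and> {x. A' t x} \<noteq> {}" if "t \<in> I" for t
    proof -
      have eq: "{x. A' t x} = {x \<in> {x. A t x}. \<forall>x' \<in> {x. A t x}. x $ i \<le> x' $ i}" by (auto simp: A'_def)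
      have "continuous_on UNIV (\<lambda>x :: real ^ 'n. x $ i)" by (intro continuous_intros)
      then show ?thesis unfolding eq using Cons.prems(2)[OF that] by (intro compact_minimisers) blast+
    qed
    ultimately obtain B where B: "semialg_family B" "\<forall>t x. B t x \<longrightarrow> A' t x" "\<forall>t\<in>I. \<exists>x. B t x"
      "\<forall>t x x'. B t x \<longrightarrow> B t x' \<longrightarrow> (\<forall>i\<in>set is. x $ i = x' $ i)"
      using Cons.IH[of A'] by blast
    have "x $ i = x' $ i" if "B t x" "B t x'" for t x x'
    proof -
      have "A' t x" "A' t x'" using B(2) that by blast+
      then show ?thesis unfolding A'_def by (intro antisym) blast+
    qed
    moreover have "A t x" if "B t x" for t x
      using B(2) that unfolding A'_def by blast
    ultimately have "(\<forall>t x. B t x \<longrightarrow> A t x) \<and>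
        (\<forall>t x x'. B t x \<longrightarrow> B t x' \<longrightarrow> (\<forall>j\<in>set (i # is). x $ j = x' $ j))"
      using B(4) unfolding list.set(2) by blast
    then show ?case using B(1,3) by blast
  qed
  moreover obtain "is" :: "'n list" where "set is = UNIV" using finite_list[of "UNIV :: 'n set"] by auto
  ultimately obtain B where B: "semialg_family B" "\<forall>t x. B t x \<longrightarrow> A t x" "\<forall>t\<in>I. \<exists>x. B t x"
      "\<forall>t x x'. B t x \<longrightarrow> B t x' \<longrightarrow> (\<forall>i\<in>UNIV. x $ i = x' $ i)" by metis
  have "\<exists>!x. B t x" if "t \<in> I" for t
    using B(3,4) that by (metis UNIV_I vec_eq_iff)
  then show ?thesis using B(1,2) by blast
qed

section \<open>Bounded variation by counting sign changes\<close>

lemma card_poly_sgn_changes: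
  fixes p :: "real poly" and t :: "nat \<Rightarrow> real"
  assumes "mono t"
  shows "card {j. j < n \<and> sgn (poly p (t j)) \<noteq> sgn (poly p (t (Suc j)))} \<le> 2 * degree p"
proof (cases "p = 0")
  case True
  then show ?thesis by simp
next
  case False
  define S where "S = {j. j < n \<and> sgn (poly p (t j)) \<noteq> sgn (poly p (t (Suc j)))}"
  define R where "R = {x. poly p x = 0}"
  have finR: "finite R" and cR: "card R \<le> degree p"
    using poly_roots_finite[OF False] card_poly_roots_bound[OF False] by (auto simp: R_def)
  have lt: "t j < t (Suc j)" if "j \<in> S" for j
    using that monoD[OF assms, of j "Suc j"] unfolding S_def by (cases "t j = t (Suc j)") auto
  have sep: "t (Suc i) \<le> t j" if "i < j" for i j using that monoD[OF assms, of "Suc i" j] by simp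
  \<comment> \<open>Each sign change is charged to a zero of \<open>p\<close>: to \<open>t j\<close>
    if that is a zero, otherwise to some \<open>z\<close> with \<open>t j < z\<close> and
    \<open>z \<le> t (Suc j)\<close>. Within each of the two classes a zero is charged at most once,
    whence the factor 2.\<close>
  define S1 where "S1 = {j\<in>S. poly p (t j) = 0}"
  define S2 where "S2 = {j\<in>S. poly p (t j) \<noteq> 0}"
  have "inj_on t S1"
  proof (rule inj_onI)
    fix i j assume "i \<in> S1" "j \<in> S1" "t i = t j"
    then show "i = j" using lt[of i] lt[of j] sep[of i j] sep[of j i]
      by (cases i j rule: linorder_cases) (auto simp: S1_def)
  qed
  moreover have "t ` S1 \<subseteq> R" by (auto simp: S1_def R_def)
  ultimately have c1: "card S1 \<le> degree p"
    using card_inj_on_le[OF _ _ finR] cR by (meson le_trans)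
  have "\<forall>j\<in>S2. \<exists>z. t j < z \<and> z \<le> t (Suc j) \<and> poly p z = 0"
  proof
    fix j assume j: "j \<in> S2"
    then have "sgn (poly p (t j)) \<noteq> sgn (poly p (t (Suc j)))" by (simp add: S2_def S_def)
    then obtain z where "min (t j) (t (Suc j)) \<le> z" "z \<le> max (t j) (t (Suc j))" "poly p z = 0"
      using poly_sgn_eq_of_no_root by blast
    moreover have "t j < t (Suc j)" using j lt by (simp add: S2_def)
    moreover have "z \<noteq> t j" using \<open>poly p z = 0\<close> j by (auto simp: S2_def)
    ultimately show "\<exists>z. t j < z \<and> z \<le> t (Suc j) \<and> poly p z = 0" by (intro exI[of _ z]) auto
  qed
  then obtain z where z: "\<forall>j\<in>S2. t j < z j \<and> z j \<le> t (Suc j) \<and> poly p (z j) = 0"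
    by (rule bchoice[THEN exE])
  have "inj_on z S2"
  proof (rule inj_onI)
    fix i j assume "i \<in> S2" "j \<in> S2" "z i = z j"
    then show "i = j" using z[rule_format, of i] z[rule_format, of j] sep[of i j] sep[of j i]
      by (cases i j rule: linorder_cases) auto
  qed
  moreover have "z ` S2 \<subseteq> R" using z by (auto simp: R_def)
  ultimately have c2: "card S2 \<le> degree p"
    using card_inj_on_le[OF _ _ finR] cR by (meson le_trans)
  have "S = S1 \<union> S2" by (auto simp: S1_def S2_def)
  then have "card S \<le> card S1 + card S2" using card_Un_le by metis
  then show ?thesis using c1 c2 by (simp add: S_def)
qed

text \<open>The variation is the integral over the levels \<open>c\<close> of the number of crossings of \<open>c\<close>.\<close>

lemma variation_le_of_level_crossings:
  fixes a :: "nat \<Rightarrow> real"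
  assumes bd: "\<And>j. \<bar>a j\<bar> \<le> M"
    and cross: "\<And>c. card {j. j < n \<and> (a j > c) \<noteq> (a (Suc j) > c)} \<le> K"
  shows "(\<Sum>j<n. \<bar>a (Suc j) - a j\<bar>) \<le> real K * (2 * M)"
proof -
  \<comment> \<open>Half-open, so that \<open>c\<close> belongs to \<open>I j\<close> exactly when
    the truth values of \<open>a j > c\<close> and \<open>a (Suc j) > c\<close> differ.\<close>
  define I where "I j = {min (a j) (a (Suc j))..<max (a j) (a (Suc j))}" for j
  have M: "M \<ge> 0" using bd[of 0] by linarith
  have pt: "(\<Sum>j<n. indicator (I j) c) \<le> real K * indicator {-M..M} c" for c
  proof -
    have I: "c \<in> I j \<longleftrightarrow> (a j > c) \<noteq> (a (Suc j) > c)" for j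
      unfolding I_def by (auto simp: min_def max_def)
    have "(\<Sum>j<n. indicator (I j) c) = (\<Sum>j<n. if c \<in> I j then 1 else (0::real))"
      by (intro sum.cong) (auto simp: indicator_def)
    also have "\<dots> = real (card {j. j < n \<and> c \<in> I j})"
      by (subst sum.If_cases) (auto simp: Int_def intro!: arg_cong[where f=card])
    finally have eq: "(\<Sum>j<n. indicator (I j) c) = real (card {j. j < n \<and> c \<in> I j})" .
    show ?thesis
    proof (cases "c \<in> {-M..M}")
      case True
      then show ?thesis unfolding eq using cross[of c] by (simp add: I)
    next
      case False
      then have "c \<notin> I j" for j using bd[of j] bd[of "Suc j"] unfolding I_def by auto
      then show ?thesis unfolding eq using False by simp
    qed
  qed
  have meas: "measure lborel (I j) = \<bar>a (Suc j) - a j\<bar>" for j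
    unfolding I_def by (simp add: min_def max_def)
  have int: "integrable lborel (indicator (I j) :: real \<Rightarrow> real)" for j
    unfolding I_def by (intro integrable_real_indicator) (auto simp: min_def max_def)
  have "(\<Sum>j<n. \<bar>a (Suc j) - a j\<bar>) = (\<Sum>j<n. integral\<^sup>L lborel (indicator (I j)))"
    by (simp add: meas[symmetric])
  also have "\<dots> = integral\<^sup>L lborel (\<lambda>c. \<Sum>j<n. indicator (I j) c)"
    using int by (intro Bochner_Integration.integral_sum[symmetric])
  also have "\<dots> \<le> integral\<^sup>L lborel (\<lambda>c. real K * indicator {-M..M} c)"
  proof (rule integral_mono)
    have "integrable lborel (indicator {-M..M} :: real \<Rightarrow> real)"
      using M by (intro integrable_real_indicator) auto
    then show "integrable lborel (\<lambda>c. real K * indicator {-M..M} c)" by (rule integrable_mult_right)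
  qed (use int pt in \<open>auto intro: Bochner_Integration.integrable_sum\<close>)
  also have "\<dots> = real K * (2 * M)" using M by simp
  finally show ?thesis .
qed

text \<open>Uniformity in the level is the point. The level \<open>c\<close> enters the polynomials
  that decide \<open>P t c\<close> through their coefficients only, so their degrees in
  \<open>t\<close>, and with them the number of crossings of \<open>c\<close> along a monotone
  sequence, are bounded independently of \<open>c\<close>.\<close>

lemma semialg_bounded_variation:
  fixes g :: "real \<Rightarrow> real"
  assumes sa: "semialg (\<lambda>e :: bool \<Rightarrow> real. P (e False) (e True))"
    and P: "\<And>t c. t \<in> I \<Longrightarrow> P t c \<longleftrightarrow> g t > c"
    and bd: "\<And>t. t \<in> I \<Longrightarrow> \<bar>g t\<bar> \<le> M"
  shows "\<exists>V. \<forall>t n. mono t \<longrightarrow> range t \<subseteq> I \<longrightarrow> (\<Sum>j<n. \<bar>g (t (Suc j)) - g (t j)\<bar>) \<le> V"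
proof -
  obtain Q where Q: "finite Q" "Q \<subseteq> polyfun"
    "\<And>e e' :: bool \<Rightarrow> real. same_signs Q e e' \<Longrightarrow> P (e False) (e True) = P (e' False) (e' True)"
    using sa unfolding semialg_def by blast
  have "\<forall>q\<in>Q. \<exists>cd. param_poly (snd cd) (fst cd) \<and> (\<forall>e x. q (e(False := x)) = poly (fst cd e) x)"
    using polyfun_as_param_poly[of _ False] Q(2) by fastforce
  then obtain cd where cd: "\<forall>q\<in>Q. param_poly (snd (cd q)) (fst (cd q)) \<and>
      (\<forall>e x. q (e(False := x)) = poly (fst (cd q) e) x)" by (rule bchoice[THEN exE])
  define K where "K = (\<Sum>q\<in>Q. 2 * snd (cd q))"
  have "(\<Sum>j<n. \<bar>g (t (Suc j)) - g (t j)\<bar>) \<le> real K * (2 * M)" if t: "mono t" "range t \<subseteq> I" for t n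
  proof (rule variation_le_of_level_crossings)
    show "\<bar>g (t j)\<bar> \<le> M" for j using bd t(2) by auto
    show "card {j. j < n \<and> (g (t j) > c) \<noteq> (g (t (Suc j)) > c)} \<le> K" for c
    proof -
      \<comment> \<open>In the environment \<open>\<lambda>_. c\<close> the entry at
        \<open>True\<close> is the level, while the entry at \<open>False\<close> is overwritten by
        the values of \<open>t\<close>.\<close>
      define p where "p q = fst (cd q) (\<lambda>_. c)" for q
      define S where "S q = {j. j < n \<and> sgn (poly (p q) (t j)) \<noteq> sgn (poly (p q) (t (Suc j)))}" for q
      have dg: "degree (p q) \<le> snd (cd q)" if "q \<in> Q" for q
        using cd that unfolding p_def param_poly_def by blast
      have cS: "card (S q) \<le> 2 * snd (cd q)" if "q \<in> Q" for q
        unfolding S_def using card_poly_sgn_changes[OF t(1), of n "p q"] dg[OF that] by linarith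
      have "{j. j < n \<and> (g (t j) > c) \<noteq> (g (t (Suc j)) > c)} \<subseteq> (\<Union>q\<in>Q. S q)"
      proof
        fix j assume "j \<in> {j. j < n \<and> (g (t j) > c) \<noteq> (g (t (Suc j)) > c)}"
        moreover have "t j \<in> I" "t (Suc j) \<in> I" using t(2) by auto
        ultimately have j: "j < n" "P (t j) c \<noteq> P (t (Suc j)) c" using P by auto
        define e where "e x = (\<lambda>_. c)(False := x)" for x
        have "\<not> same_signs Q (e (t j)) (e (t (Suc j)))"
          using Q(3)[of "e (t j)" "e (t (Suc j))"] j(2) by (auto simp: e_def)
        then obtain q where q: "q \<in> Q" "sgn (q (e (t j))) \<noteq> sgn (q (e (t (Suc j))))"
          unfolding same_signs_def by blast
        then have "j \<in> S q" using cd j(1) unfolding S_def p_def e_def by auto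
        then show "j \<in> (\<Union>q\<in>Q. S q)" using q by blast
      qed
      then have "card {j. j < n \<and> (g (t j) > c) \<noteq> (g (t (Suc j)) > c)} \<le> card (\<Union>q\<in>Q. S q)"
        using Q(1) by (intro card_mono) (auto simp: S_def)
      also have "\<dots> \<le> (\<Sum>q\<in>Q. card (S q))" using Q(1) by (rule card_UN_le)
      also have "\<dots> \<le> K" unfolding K_def using cS by (intro sum_mono)
      finally show ?thesis .
    qed
  qed
  then show ?thesis by blast
qed

section \<open>Finite length of semialgebraic gradient descent\<close>

text \<open>Gives superadditivity of the variation over adjacent ranges. The additional index
  accounts for the step from \<open>t n\<close> to \<open>s 0\<close>, whose contribution is
  nonnegative.\<close>

lemma concat_partitions:
  fixes t s :: "nat \<Rightarrow> real"
  assumes "mono t" "mono s" "t n \<le> s 0"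
  obtains u where "mono u" "range u \<subseteq> range t \<union> range s"
    "\<And>d :: real \<Rightarrow> real \<Rightarrow> real. (\<And>x y. 0 \<le> d x y) \<Longrightarrow>
      (\<Sum>j<n. d (t j) (t (Suc j))) + (\<Sum>j<m. d (s j) (s (Suc j))) \<le> (\<Sum>j<Suc n + m. d (u j) (u (Suc j)))"
proof
  define u where "u j = (if j \<le> n then t j else s (j - Suc n))" for j
  show "mono u"
  proof (rule monoI)
    fix i j :: nat assume "i \<le> j"
    have "t i \<le> t n" if "i \<le> n" using monoD[OF assms(1) that] .
    moreover have "s 0 \<le> s k" for k using monoD[OF assms(2), of 0 k] by simp
    then have "t n \<le> s (j - Suc n)" using assms(3) order_trans by blast
    ultimately show "u i \<le> u j"
      using \<open>i \<le> j\<close> assms(3) monoD[OF assms(1) \<open>i \<le> j\<close>] monoD[OF assms(2), of "i - Suc n" "j - Suc n"]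
      by (auto simp: u_def intro: order_trans)
  qed
  show "range u \<subseteq> range t \<union> range s" by (auto simp: u_def)
  fix d :: "real \<Rightarrow> real \<Rightarrow> real" assume d: "\<And>x y. 0 \<le> d x y"
  have "(\<Sum>j<Suc n + m. d (u j) (u (Suc j))) =
      (\<Sum>j<Suc n. d (u j) (u (Suc j))) + (\<Sum>j<m. d (s j) (s (Suc j)))"
    by (induction m) (simp_all add: u_def)
  moreover have "(\<Sum>j<n. d (u j) (u (Suc j))) = (\<Sum>j<n. d (t j) (t (Suc j)))"
    by (intro sum.cong) (auto simp: u_def)
  ultimately show "(\<Sum>j<n. d (t j) (t (Suc j))) + (\<Sum>j<m. d (s j) (s (Suc j))) \<le> (\<Sum>j<Suc n + m. d (u j) (u (Suc j)))"
    using d[of "u n" "u (Suc n)"] by simp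
qed

text \<open>\<open>v a\<close> is the variation of \<open>x\<close> over the part of
  \<open>I\<close> up to \<open>a\<close>, a supremum that is finite by \<open>V\<close>. Its
  increments dominate the variation over each range of levels, so that estimates on successive
  ranges telescope.\<close>

lemma variation_function:
  fixes x :: "real \<Rightarrow> 'a::real_normed_vector"
  assumes V: "\<And>t n. mono t \<Longrightarrow> range t \<subseteq> I \<Longrightarrow> (\<Sum>j<n. norm (x (t (Suc j)) - x (t j))) \<le> V"
  shows "\<exists>v :: real \<Rightarrow> real. (\<forall>a\<in>I. 0 \<le> v a) \<and>
    (\<forall>a b s m. a \<in> I \<longrightarrow> mono s \<longrightarrow> range s \<subseteq> I \<inter> {a..b} \<longrightarrow>
      v a + (\<Sum>j<m. norm (x (s (Suc j)) - x (s j))) \<le> v b)"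
proof -
  define W where "W a = {\<Sum>j<n. norm (x (t (Suc j)) - x (t j)) | t n. mono t \<and> range t \<subseteq> I \<inter> {..a}}" for a
  have bdd: "bdd_above (W a)" for a
    unfolding bdd_above_def W_def using V by (intro exI[of _ V]) auto
  have zero: "0 \<in> W a" if "a \<in> I" for a
  proof -
    have "mono (\<lambda>_::nat. a) \<and> range (\<lambda>_::nat. a) \<subseteq> I \<inter> {..a}" using that by (auto simp: mono_def)
    then show ?thesis unfolding W_def by (intro CollectI exI[of _ "\<lambda>_. a"] exI[of _ 0]) simp
  qed
  have "\<forall>a\<in>I. 0 \<le> Sup (W a)" using cSup_upper[OF zero bdd] by blast
  moreover have "Sup (W a) + (\<Sum>j<m. norm (x (s (Suc j)) - x (s j))) \<le> Sup (W b)"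
    if a: "a \<in> I" and s: "mono s" "range s \<subseteq> I \<inter> {a..b}" for a b s m
  proof -
    let ?S = "\<Sum>j<m. norm (x (s (Suc j)) - x (s j))"
    have ab: "a \<le> b" using s(2) by fastforce
    have "Sup (W a) \<le> Sup (W b) - ?S"
    proof (rule cSup_least)
      show "W a \<noteq> {}" using zero[OF a] by blast
      fix r assume "r \<in> W a"
      then obtain t n where t: "mono t" "range t \<subseteq> I \<inter> {..a}" and r: "r = (\<Sum>j<n. norm (x (t (Suc j)) - x (t j)))"
        unfolding W_def by blast
      have "t n \<in> I \<inter> {..a}" "s 0 \<in> I \<inter> {a..b}" using t(2) s(2) by (auto simp only: image_subset_iff)
      then have ts: "t n \<le> s 0" by simp
      obtain u where u: "mono u" "range u \<subseteq> range t \<union> range s"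
        "\<And>d :: real \<Rightarrow> real \<Rightarrow> real. (\<And>x y. 0 \<le> d x y) \<Longrightarrow>
          (\<Sum>j<n. d (t j) (t (Suc j))) + (\<Sum>j<m. d (s j) (s (Suc j))) \<le> (\<Sum>j<Suc n + m. d (u j) (u (Suc j)))"
        using concat_partitions[OF t(1) s(1) ts, of m] by blast
      have "range t \<union> range s \<subseteq> I \<inter> {..b}"
      proof (rule Un_least)
        have "I \<inter> {..a} \<subseteq> I \<inter> {..b}" using ab by auto
        then show "range t \<subseteq> I \<inter> {..b}" using t(2) by (rule order_trans[rotated])
        show "range s \<subseteq> I \<inter> {..b}" using s(2) by auto
      qed
      then have "range u \<subseteq> I \<inter> {..b}" using u(2) by (rule order_trans[rotated])
      then have "(\<Sum>j<Suc n + m. norm (x (u (Suc j)) - x (u j))) \<in> W b"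
        unfolding W_def using u(1) by blast
      then have "(\<Sum>j<Suc n + m. norm (x (u (Suc j)) - x (u j))) \<le> Sup (W b)"
        using bdd by (rule cSup_upper)
      then show "r \<le> Sup (W b) - ?S"
        using u(3)[of "\<lambda>p q. norm (x q - x p)"] unfolding r by simp
    qed
    then show ?thesis by simp
  qed
  ultimately show ?thesis by (intro exI[of _ "\<lambda>a. Sup (W a)"]) blast
qed

text \<open>A fine partition makes the quadratic error term harmless even where the curve \<open>x\<close> jumps,
  because its variation is finite.\<close>

lemma height_le_gradient_times_variation:
  fixes F :: "'a::real_inner \<Rightarrow> real"
  assumes L: "0 \<le> L" and up: "\<And>x u. F u \<le> F x + G x \<bullet> (u - x) + L / 2 * (norm (u - x))\<^sup>2"
    and ab: "a \<le> b" and \<gamma>: "0 < \<gamma>" and C: "0 \<le> C"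
    and x: "\<And>\<tau>. a \<le> \<tau> \<Longrightarrow> \<tau> \<le> b \<Longrightarrow> F (x \<tau>) = \<tau> \<and> norm (G (x \<tau>)) \<le> C * \<gamma>"
    and V: "\<And>t n. mono t \<Longrightarrow> range t \<subseteq> {a..b} \<Longrightarrow> (\<Sum>j<n. norm (x (t (Suc j)) - x (t j))) \<le> V"
  shows "\<exists>t N. mono t \<and> range t \<subseteq> {a..b} \<and>
    b - a \<le> 2 * (C + L / 2) * \<gamma> * (\<Sum>j<N. norm (x (t (Suc j)) - x (t j)))"
proof -
  \<comment> \<open>Large enough that, for the mesh \<open>h = (b - a) / N\<close>, the error
    \<open>h / \<gamma> * V\<close> is at most half of \<open>b - a\<close>. It is absorbed on the
    left, which produces the factor 2 in the conclusion.\<close>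
  obtain N0 :: nat where N0: "2 * V / \<gamma> \<le> real N0" using real_arch_simple by blast
  define N where "N = Suc N0"
  have N: "N > 0" "2 * V / \<gamma> \<le> real N" using N0 by (auto simp: N_def)
  define h where "h = (b - a) / N"
  have h: "0 \<le> h" "h * N = b - a" using ab N by (auto simp: h_def)
  \<comment> \<open>The cap \<open>min j N\<close> keeps the sequence at \<open>b\<close> from the
    index \<open>N\<close> on, hence inside \<open>{a..b}\<close>.\<close>
  define t where "t j = a + real (min j N) * h" for j
  have mono: "mono t" unfolding t_def using h by (auto simp: mono_def intro!: mult_right_mono)
  have rng: "range t \<subseteq> {a..b}"
  proof -
    have "real (min j N) * h \<le> real N * h" for j using h by (intro mult_right_mono) auto
    then show ?thesis using h unfolding t_def by (auto simp: algebra_simps intro!: mult_nonneg_nonneg)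
  qed
  define d where "d j = norm (x (t (Suc j)) - x (t j))" for j
  \<comment> \<open>If \<open>d j \<le> \<gamma>\<close>, the quadratic term is at most
    \<open>L / 2 * \<gamma> * d j\<close>. For a jump \<open>d j > \<gamma>\<close> the trivial
    bound \<open>h \<le> h / \<gamma> * d j\<close> suffices, and the variation controls the sum of
    these terms.\<close>
  have step: "h \<le> (C + L / 2) * \<gamma> * d j + h / \<gamma> * d j" if "j < N" for j
  proof -
    have tj: "t j \<in> {a..b}" "t (Suc j) \<in> {a..b}" using rng by blast+
    have "t (Suc j) - t j = h" using that by (simp add: t_def algebra_simps)
    moreover have "F (x (t (Suc j))) \<le> F (x (t j)) + G (x (t j)) \<bullet> (x (t (Suc j)) - x (t j)) + L / 2 * (d j)\<^sup>2"
      unfolding d_def by (rule up)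
    moreover have "G (x (t j)) \<bullet> (x (t (Suc j)) - x (t j)) \<le> C * \<gamma> * d j"
    proof -
      have "G (x (t j)) \<bullet> (x (t (Suc j)) - x (t j)) \<le> norm (G (x (t j))) * d j"
        unfolding d_def by (rule norm_cauchy_schwarz)
      also have "\<dots> \<le> C * \<gamma> * d j" using x[of "t j"] tj by (intro mult_right_mono) (auto simp: d_def)
      finally show ?thesis .
    qed
    ultimately have *: "h \<le> C * \<gamma> * d j + L / 2 * (d j)\<^sup>2" using x[of "t j"] x[of "t (Suc j)"] tj by auto
    have dj: "0 \<le> d j" by (simp add: d_def)
    show ?thesis
    proof (cases "d j \<le> \<gamma>")
      case True
      then have "L / 2 * (d j)\<^sup>2 \<le> L / 2 * (\<gamma> * d j)"
        using L dj by (intro mult_left_mono) (auto simp: power2_eq_square intro: mult_right_mono)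
      moreover have "0 \<le> h / \<gamma> * d j" using h \<gamma> dj by simp
      ultimately show ?thesis using * by (simp add: algebra_simps)
    next
      case False
      then have "h * 1 \<le> h * (d j / \<gamma>)" using h \<gamma> by (intro mult_left_mono) auto
      moreover have "0 \<le> (C + L / 2) * \<gamma> * d j" using C L \<gamma> dj by simp
      ultimately show ?thesis by simp
    qed
  qed
  define S where "S = (\<Sum>j<N. d j)"
  have S: "S \<le> V" unfolding S_def d_def by (rule V[OF mono rng])
  have "b - a = (\<Sum>j<N. h)" using h by (simp add: mult.commute)
  also have "\<dots> \<le> (\<Sum>j<N. (C + L / 2) * \<gamma> * d j + h / \<gamma> * d j)" using step by (intro sum_mono) auto
  also have "\<dots> = (C + L / 2) * \<gamma> * S + h / \<gamma> * S" by (simp add: S_def sum.distrib sum_distrib_left)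
  finally have "b - a \<le> (C + L / 2) * \<gamma> * S + h / \<gamma> * S" .
  moreover have "h / \<gamma> * S \<le> h / \<gamma> * V" using S h \<gamma> by (intro mult_left_mono) auto
  moreover have "h / \<gamma> * V \<le> (b - a) / 2"
  proof -
    have "h * (2 * V / \<gamma>) \<le> h * real N" using N h by (intro mult_left_mono) auto
    then show ?thesis using h by (simp add: field_simps)
  qed
  moreover have "p \<le> 2 * x" if "p \<le> x + u" "u \<le> v" "v \<le> p / 2" for p x u v :: real
    using that by linarith
  ultimately have "b - a \<le> 2 * ((C + L / 2) * \<gamma> * S)" by blast
  then have "b - a \<le> 2 * (C + L / 2) * \<gamma> * S" by (simp only: mult.assoc)
  then show ?thesis using mono rng unfolding S_def d_def by blast
qed

theorem semialg_gradient_descent_finite_length: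
  fixes F :: "real ^ 'n \<Rightarrow> real" and G :: "real ^ 'n \<Rightarrow> real ^ 'n" and w :: "nat \<Rightarrow> real ^ 'n"
  assumes F_sa: "semialg (\<lambda>e :: 'n option \<Rightarrow> real. F (\<chi> i. e (Some i)) = e None)"
    and G_sa: "semialg (\<lambda>e :: 'n + 'n \<Rightarrow> real. norm (G (\<chi> i. e (Inl i))) \<le> norm (G (\<chi> i. e (Inr i))))"
    and contF: "continuous_on UNIV F"
    and L: "0 < L" and up: "\<And>x u. F u \<le> F x + G x \<bullet> (u - x) + L / 2 * (norm (u - x))\<^sup>2"
    and C: "0 \<le> C" and lip: "\<And>x u. norm (G u - G x) \<le> C * norm (u - x)"
    and \<alpha>: "0 < \<alpha>" "\<alpha> < 2 / L" and w: "\<And>k. w (Suc k) = w k - \<alpha> *\<^sub>R G (w k)"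
    and M: "\<And>k. norm (w k) \<le> M"
  shows "summable (\<lambda>k. norm (w (Suc k) - w k))"
proof -
  have M0: "0 \<le> M" using M[of 0] norm_ge_zero[of "w 0"] by linarith
  have contG: "continuous_on UNIV (\<lambda>x. norm (G x))"
  proof -
    have "C-lipschitz_on UNIV G" using C lip by (intro lipschitz_onI) (auto simp: dist_norm)
    then show ?thesis by (intro continuous_on_norm lipschitz_on_continuous_on)
  qed
  define I where "I = F ` cball 0 M"
  \<comment> \<open>Intersecting the level set with a ball makes it compact, so that a least
    gradient norm is attained. The ball is convex and therefore contains the segments between
    iterates too.\<close>
  define A where "A t x \<longleftrightarrow> norm x \<le> M \<and> F x = t" for t and x :: "real ^ 'n"
  have "semialg_family A"
  proof -
    have "(\<lambda>e :: 'n option \<Rightarrow> real. \<Sum>i\<in>UNIV. (e (Some i))\<^sup>2) \<in> polyfun"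
      by (intro polyfun_sum polyfun_power polyfun_var)
    then have "semialg (\<lambda>e :: 'n option \<Rightarrow> real. (\<Sum>i\<in>UNIV. (e (Some i))\<^sup>2) \<le> M\<^sup>2)"
      by (intro semialg_fun_le semialg_fun_polyfun polyfun_const)
    moreover have "norm (\<chi> i. e (Some i)) \<le> M \<longleftrightarrow> (\<Sum>i\<in>UNIV. (e (Some i))\<^sup>2) \<le> M\<^sup>2" for e :: "'n option \<Rightarrow> real"
      using M0 by (simp add: norm_vec_def L2_set_def real_sqrt_le_iff' sum_nonneg)
    ultimately show ?thesis unfolding semialg_family_def A_def using F_sa by (simp add: semialg_conj)
  qed
  define A1 where "A1 t x \<longleftrightarrow> A t x \<and> (\<forall>x'. A t x' \<longrightarrow> norm (G x) \<le> norm (G x'))" for t x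
  have A1: "semialg_family A1"
    unfolding A1_def by (rule semialg_family_minimisers[OF \<open>semialg_family A\<close> G_sa])
  have cA1: "compact {x. A1 t x} \<and> {x. A1 t x} \<noteq> {}" if "t \<in> I" for t
  proof -
    have "{x. A t x} = cball 0 M \<inter> {x. F x = t}" by (auto simp: A_def)
    moreover have "closed {x. F x = t}" using contF by (intro closed_Collect_eq) auto
    ultimately have "compact {x. A t x}" by (simp add: compact_Int_closed)
    moreover have "{x. A t x} \<noteq> {}" using that by (auto simp: A_def I_def)
    moreover have "{x. A1 t x} = {x \<in> {x. A t x}. \<forall>x' \<in> {x. A t x}. norm (G x) \<le> norm (G x')}"
      by (auto simp: A1_def)
    ultimately show ?thesis using compact_minimisers[OF _ _ contG] by presburger
  qed
  have "\<exists>B. semialg_family B \<and> (\<forall>t x. B t x \<longrightarrow> A1 t x) \<and> (\<forall>t\<in>I. \<exists>!x. B t x)"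
    by (rule semialg_family_selection[OF A1 cA1])
  then obtain B where B: "semialg_family B" "\<forall>t x. B t x \<longrightarrow> A1 t x" "\<forall>t\<in>I. \<exists>!x. B t x"
    by blast
  define x where "x t = (THE x. B t x)" for t
  have xB: "B t (x t)" and xu: "B t z \<Longrightarrow> z = x t" if "t \<in> I" for t z
  proof -
    have ex1: "\<exists>!x. B t x" using B(3) that by blast
    show "B t (x t)" unfolding x_def by (rule theI'[OF ex1])
    show "z = x t" if "B t z" unfolding x_def by (rule the1_equality[OF ex1 that, symmetric])
  qed
  have x: "norm (x t) \<le> M" "F (x t) = t" "\<And>u. norm u \<le> M \<Longrightarrow> F u = t \<Longrightarrow> norm (G (x t)) \<le> norm (G u)"
    if "t \<in> I" for t
    using xB[OF that] B(2) unfolding A1_def A_def by blast+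
  \<comment> \<open>Since the selected point is unique, \<open>c < x t $ i\<close> can be written as
    \<open>\<exists>f. B t (\<chi> j. f j) \<and> c < f i\<close>, and eliminating this quantifier
    makes the condition semialgebraic in \<open>t\<close> and \<open>c\<close>.\<close>
  have bv: "\<exists>V. \<forall>t n. mono t \<longrightarrow> range t \<subseteq> I \<longrightarrow> (\<Sum>j<n. \<bar>x (t (Suc j)) $ i - x (t j) $ i\<bar>) \<le> V" for i
  proof (rule semialg_bounded_variation)
    have "semialg (\<lambda>e :: 'n + bool \<Rightarrow> real. B (e (Inr False)) (\<chi> j. e (Inl j)) \<and> e (Inr True) < e (Inl i))"
      by (intro semialg_conj semialg_family_subst[OF B(1)] semialg_fun_less semialg_fun_polyfun polyfun_var)
    then have "semialg (\<lambda>e :: bool \<Rightarrow> real. \<exists>f. B (e False) (\<chi> j. f j) \<and> e True < f i)"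
      by (rule semialg_ex)
    then show "semialg (\<lambda>e :: bool \<Rightarrow> real. (\<lambda>t c. \<exists>f. B t (\<chi> j. f j) \<and> c < f i) (e False) (e True))"
      by simp
    show "(\<exists>f. B t (\<chi> j. f j) \<and> c < f i) \<longleftrightarrow> c < x t $ i" if "t \<in> I" for t c
    proof
      assume "\<exists>f. B t (\<chi> j. f j) \<and> c < f i"
      then obtain f where "B t (\<chi> j. f j)" "c < f i" by blast
      then show "c < x t $ i" using xu[OF that] by (metis vec_lambda_beta)
    next
      assume "c < x t $ i"
      then show "\<exists>f. B t (\<chi> j. f j) \<and> c < f i" using xB[OF that]
        by (intro exI[of _ "\<lambda>j. x t $ j"]) simp
    qed
    show "\<bar>x t $ i\<bar> \<le> M" if "t \<in> I" for t
      using x(1)[OF that] component_le_norm_cart[of "x t" i] by linarith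
  qed
  obtain V where "\<forall>i. \<forall>t n. mono t \<longrightarrow> range t \<subseteq> I \<longrightarrow> (\<Sum>j<n. \<bar>x (t (Suc j)) $ i - x (t j) $ i\<bar>) \<le> V i"
    by (rule choice[OF allI, OF bv, THEN exE])
  then have V: "(\<Sum>j<n. \<bar>x (t (Suc j)) $ i - x (t j) $ i\<bar>) \<le> V i" if "mono t" "range t \<subseteq> I" for i t n
    using that by blast
  define V' where "V' = (\<Sum>i\<in>UNIV. V i)"
  have V': "(\<Sum>j<n. norm (x (t (Suc j)) - x (t j))) \<le> V'" if t: "mono t" "range t \<subseteq> I" for t n
  proof -
    have "(\<Sum>j<n. norm (x (t (Suc j)) - x (t j))) \<le> (\<Sum>j<n. \<Sum>i\<in>UNIV. \<bar>x (t (Suc j)) $ i - x (t j) $ i\<bar>)"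
      by (intro sum_mono order_trans[OF norm_le_l1_cart]) simp
    also have "\<dots> = (\<Sum>i\<in>UNIV. \<Sum>j<n. \<bar>x (t (Suc j)) $ i - x (t j) $ i\<bar>)" by (rule sum.swap)
    also have "\<dots> \<le> V'" unfolding V'_def by (intro sum_mono V t)
    finally show ?thesis .
  qed
  have "\<exists>v :: real \<Rightarrow> real. (\<forall>a\<in>I. 0 \<le> v a) \<and>
    (\<forall>a b s m. a \<in> I \<longrightarrow> mono s \<longrightarrow> range s \<subseteq> I \<inter> {a..b} \<longrightarrow>
      v a + (\<Sum>j<m. norm (x (s (Suc j)) - x (s j))) \<le> v b)"
    by (rule variation_function[OF V'])
  then obtain v :: "real \<Rightarrow> real" where v0: "\<forall>a\<in>I. 0 \<le> v a" and v1: "\<forall>a b s m. a \<in> I \<longrightarrow> mono s \<longrightarrow>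
      range s \<subseteq> I \<inter> {a..b} \<longrightarrow> v a + (\<Sum>j<m. norm (x (s (Suc j)) - x (s j))) \<le> v b"
    by (elim exE conjE)
  have v: "0 \<le> v a" "mono s \<Longrightarrow> range s \<subseteq> I \<inter> {a..b} \<Longrightarrow>
      v a + (\<Sum>j<m. norm (x (s (Suc j)) - x (s j))) \<le> v b" if "a \<in> I" for a b s m
    using v0 v1 that by simp_all
  define f where "f k = F (w k)" for k
  have fI: "f k \<in> I" for k using M by (auto simp: f_def I_def)
  \<comment> \<open>The descent constant: inserting the step into \<open>up\<close> gives
    \<open>L / 2 - 1 / \<alpha>\<close> in front of its squared length, which is negative because
    \<open>\<alpha> < 2 / L\<close>.\<close>
  define c where "c = 1 / \<alpha> - L / 2"
  have c: "c > 0" using \<alpha> L by (simp add: c_def field_simps)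
  have descent: "c * (norm (w (Suc k) - w k))\<^sup>2 \<le> f k - f (Suc k)" for k
  proof -
    have "G (w k) = - (1 / \<alpha>) *\<^sub>R (w (Suc k) - w k)" using w[of k] \<alpha> by simp
    then have "G (w k) \<bullet> (w (Suc k) - w k) = - (1 / \<alpha>) * (norm (w (Suc k) - w k))\<^sup>2"
      by (simp add: power2_norm_eq_inner)
    then show ?thesis using up[of "w (Suc k)" "w k"] by (simp add: f_def c_def algebra_simps)
  qed
  \<comment> \<open>The numerator is the constant of the height estimate for gradients bounded by
    \<open>(1 + C * \<alpha>) * \<gamma>\<close>. The denominator is what remains of the descent
    term \<open>c * (\<alpha> * \<gamma>)\<^sup>2\<close> after dividing by \<open>\<gamma>\<close>
    and splitting off the step length \<open>\<alpha> * \<gamma>\<close>.\<close>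
  define D where "D = 2 * (1 + C * \<alpha> + L / 2) / (c * \<alpha>)"
  have D: "D \<ge> 0" using C \<alpha> L c by (simp add: D_def)
  have main: "norm (w (Suc k) - w k) \<le> D * (v (f k) - v (f (Suc k)))" for k
  proof -
    define a b where "a = f (Suc k)" and "b = f k"
    have ab: "a \<le> b" using descent[of k] c by (simp add: a_def b_def) (smt (verit) mult_nonneg_nonneg zero_le_power2)
    define \<gamma> where "\<gamma> = norm (G (w k))"
    have \<Delta>: "norm (w (Suc k) - w k) = \<alpha> * \<gamma>" using w[of k] \<alpha> by (simp add: \<gamma>_def)
    have lev: "\<tau> \<in> I \<and> norm (G (x \<tau>)) \<le> (1 + C * \<alpha>) * \<gamma>" if \<tau>: "a \<le> \<tau>" "\<tau> \<le> b" for \<tau>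
    proof -
      define p where "p s = w k + s *\<^sub>R (w (Suc k) - w k)" for s
      have "continuous_on {0..1} (\<lambda>s. F (p s))"
        unfolding p_def by (intro continuous_on_compose2[OF contF] continuous_intros) auto
      then have "\<exists>s\<ge>0. s \<le> 1 \<and> F (p s) = \<tau>"
        using \<tau> by (intro IVT2') (auto simp: p_def a_def b_def f_def)
      then obtain s where s: "0 \<le> s" "s \<le> 1" "F (p s) = \<tau>" by blast
      have "p s = (1 - s) *\<^sub>R w k + s *\<^sub>R w (Suc k)" by (simp add: p_def algebra_simps)
      then have "p s \<in> cball 0 M"
        using convexD_alt[OF convex_cball, of "w k" 0 M "w (Suc k)" s] M s by simp
      then have pM: "norm (p s) \<le> M" by simp
      then have \<tau>I: "\<tau> \<in> I" using s(3) by (auto simp: I_def)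
      have "norm (G (p s)) \<le> \<gamma> + norm (G (p s) - G (w k))"
        unfolding \<gamma>_def by (metis add.commute diff_add_cancel norm_triangle_ineq)
      also have "norm (G (p s) - G (w k)) \<le> C * (s * (\<alpha> * \<gamma>))"
        using lip[of "p s" "w k"] s unfolding \<Delta>[symmetric] by (simp add: p_def)
      also have "C * (s * (\<alpha> * \<gamma>)) \<le> C * (1 * (\<alpha> * \<gamma>))"
        using C s \<alpha> by (intro mult_left_mono mult_right_mono) (auto simp: \<gamma>_def)
      finally have "norm (G (p s)) \<le> (1 + C * \<alpha>) * \<gamma>" by (simp add: algebra_simps)
      then show ?thesis using x(3)[OF \<tau>I pM s(3)] \<tau>I by simp
    qed
    have sub: "{a..b} \<subseteq> I" using lev by auto
    show ?thesis
    proof (cases "\<gamma> = 0")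
      case True
      \<comment> \<open>With an empty sum the property of \<open>v\<close> becomes monotonicity,
        which is enough for a step of length 0.\<close>
      have "v a + (\<Sum>j<0. norm (x ((\<lambda>_::nat. a) (Suc j)) - x ((\<lambda>_. a) j))) \<le> v b"
        using fI[of "Suc k"] ab by (intro v(2)) (auto simp: a_def mono_def)
      then have "0 \<le> D * (v b - v a)" using D by simp
      then show ?thesis unfolding \<Delta> True a_def b_def by simp
    next
      case False
      then have \<gamma>: "\<gamma> > 0" by (simp add: \<gamma>_def)
      have "\<exists>t N. mono t \<and> range t \<subseteq> {a..b} \<and>
          b - a \<le> 2 * (1 + C * \<alpha> + L / 2) * \<gamma> * (\<Sum>j<N. norm (x (t (Suc j)) - x (t j)))"
      proof (rule height_le_gradient_times_variation[where F = F and G = G and V = V', OF _ up ab \<gamma>])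
        show "F (x \<tau>) = \<tau> \<and> norm (G (x \<tau>)) \<le> (1 + C * \<alpha>) * \<gamma>" if "a \<le> \<tau>" "\<tau> \<le> b" for \<tau>
          using lev[OF that] x(2) by blast
      qed (use L C \<alpha> V' sub in auto)
      then obtain t N where t: "mono t" "range t \<subseteq> {a..b}"
        and le: "b - a \<le> 2 * (1 + C * \<alpha> + L / 2) * \<gamma> * (\<Sum>j<N. norm (x (t (Suc j)) - x (t j)))" by blast
      have "v a + (\<Sum>j<N. norm (x (t (Suc j)) - x (t j))) \<le> v b"
        using fI[of "Suc k"] t sub by (intro v(2)) (auto simp: a_def)
      then have "2 * (1 + C * \<alpha> + L / 2) * \<gamma> * (\<Sum>j<N. norm (x (t (Suc j)) - x (t j)))
          \<le> 2 * (1 + C * \<alpha> + L / 2) * \<gamma> * (v b - v a)"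
        using C \<alpha> L \<gamma> by (intro mult_left_mono) auto
      then have "c * (\<alpha> * \<gamma>)\<^sup>2 \<le> 2 * (1 + C * \<alpha> + L / 2) * \<gamma> * (v b - v a)"
        using le descent[of k] unfolding \<Delta> a_def b_def by linarith
      then have "\<gamma> * (c * \<alpha> * (\<alpha> * \<gamma>)) \<le> \<gamma> * (2 * (1 + C * \<alpha> + L / 2) * (v b - v a))"
        by (simp add: power2_eq_square algebra_simps)
      then have "c * \<alpha> * (\<alpha> * \<gamma>) \<le> 2 * (1 + C * \<alpha> + L / 2) * (v b - v a)"
        using \<gamma> by (simp only: mult_le_cancel_left_pos)
      moreover have "0 < c * \<alpha>" using c \<alpha> by simp
      ultimately have "\<alpha> * \<gamma> \<le> 2 * (1 + C * \<alpha> + L / 2) * (v b - v a) / (c * \<alpha>)"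
        by (simp add: pos_le_divide_eq mult.commute)
      then show ?thesis unfolding \<Delta> D_def a_def b_def by simp
    qed
  qed
  have "(\<Sum>k<n. norm (w (Suc k) - w k)) \<le> D * v (f 0)" for n
  proof -
    have "(\<Sum>k<n. norm (w (Suc k) - w k)) \<le> (\<Sum>k<n. D * (v (f k) - v (f (Suc k))))"
      by (intro sum_mono main)
    also have "\<dots> = D * (v (f 0) - v (f n))"
      by (induction n) (simp_all add: algebra_simps)
    also have "\<dots> \<le> D * v (f 0)" using D v(1)[OF fI, of n] by (intro mult_left_mono) auto
    finally show ?thesis .
  qed
  then show ?thesis by (intro summableI_nonneg_bounded) auto
qed

section \<open>The reduced loss\<close>

text \<open>The minimum over \<open>z\<close> of \<open>(r - z)\<^sup>2 / 2 + \<delta> |z| / S \<delta> r\<close>, attained at \<open>shrink \<delta> r\<close>. The maximum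
  merges the cases \<open>r\<^sup>2 / 2\<close> for \<open>r\<^sup>2 \<le> \<delta>\<close> and \<open>\<delta> - \<delta>\<^sup>2 / (2 r\<^sup>2)\<close> for \<open>r\<^sup>2 > \<delta>\<close>.\<close>

definition loss :: "real \<Rightarrow> real \<Rightarrow> real" where
  "loss \<delta> r = \<delta> - \<delta>\<^sup>2 / 2 * inverse (max (r\<^sup>2) \<delta>) + (r\<^sup>2 - max (r\<^sup>2) \<delta>) / 2"

definition loss_deriv :: "real \<Rightarrow> real \<Rightarrow> real" where
  "loss_deriv \<delta> r = \<delta>\<^sup>2 * r * (inverse (max (r\<^sup>2) \<delta>))\<^sup>2"

definition shrink :: "real \<Rightarrow> real \<Rightarrow> real" where
  "shrink \<delta> r = (if \<bar>r\<bar> \<le> sqrt \<delta> then 0 else r - \<delta> / r)"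

lemma abs_le_sqrt_iff: "\<bar>r\<bar> \<le> sqrt \<delta> \<longleftrightarrow> r\<^sup>2 \<le> \<delta>"
  by (metis real_sqrt_abs real_sqrt_le_iff)

lemma loss_small: "r\<^sup>2 \<le> \<delta> \<Longrightarrow> 0 < \<delta> \<Longrightarrow> loss \<delta> r = r\<^sup>2 / 2"
  by (simp add: loss_def max_def power2_eq_square field_simps)

lemma loss_large: "\<delta> < r\<^sup>2 \<Longrightarrow> loss \<delta> r = \<delta> - \<delta>\<^sup>2 / (2 * r\<^sup>2)"
  by (simp add: loss_def max_def field_simps)

lemma loss_deriv_small: "r\<^sup>2 \<le> \<delta> \<Longrightarrow> 0 < \<delta> \<Longrightarrow> loss_deriv \<delta> r = r"
  by (simp add: loss_deriv_def max_def power2_eq_square field_simps)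

lemma loss_deriv_large: "\<delta> < r\<^sup>2 \<Longrightarrow> 0 < \<delta> \<Longrightarrow> loss_deriv \<delta> r = \<delta>\<^sup>2 / r ^ 3"
  by (cases "r = 0") (simp_all add: loss_deriv_def max_def power2_eq_square power3_eq_cube field_simps)

lemma S_small:
  assumes "r\<^sup>2 \<le> \<delta>" "0 < \<delta>"
  shows "0 < S \<delta> r" "S \<delta> r \<le> sqrt \<delta>" "\<bar>r\<bar> \<le> S \<delta> r"
proof -
  let ?s = "sqrt \<delta>"
  have s: "?s > 0" "?s * ?s = \<delta>" using assms by auto
  have r: "\<bar>r\<bar> \<le> ?s" using assms(1) by (simp only: abs_le_sqrt_iff)
  \<comment> \<open>The two branches of \<open>S\<close> agree at the threshold, so the quadratic
    formula holds there as well.\<close>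
  have eq: "S \<delta> r = r\<^sup>2 / (2 * ?s) + ?s / 2"
  proof (cases "\<bar>r\<bar> < ?s")
    case False
    then have "\<bar>r\<bar> = ?s" using r by simp
    then have r2: "r\<^sup>2 = ?s * ?s" by (metis power2_abs power2_eq_square)
    have "r\<^sup>2 / (2 * ?s) = ?s / 2" unfolding r2 using s(1) by (simp del: real_sqrt_mult_self)
    then show ?thesis using False \<open>\<bar>r\<bar> = ?s\<close> by (simp add: S_def)
  qed (simp add: S_def)
  have "0 \<le> r\<^sup>2 / (2 * ?s)" using s by simp
  then show "0 < S \<delta> r" unfolding eq using s by linarith
  have "r\<^sup>2 / (2 * ?s) \<le> (?s * ?s) / (2 * ?s)" using assms(1) s by (intro divide_right_mono) auto
  moreover have "(?s * ?s) / (2 * ?s) = ?s / 2" using s(1) by (simp del: real_sqrt_mult_self)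
  ultimately show "S \<delta> r \<le> ?s" unfolding eq by linarith
  have "0 \<le> (\<bar>r\<bar> - ?s)\<^sup>2 / (2 * ?s)" using s by simp
  also have "\<dots> = r\<^sup>2 / (2 * ?s) + ?s / 2 - \<bar>r\<bar>"
    using s(1) by (simp add: power2_diff field_simps)
  finally show "\<bar>r\<bar> \<le> S \<delta> r" unfolding eq by simp
qed

lemma S_large: "\<delta> < r\<^sup>2 \<Longrightarrow> S \<delta> r = \<bar>r\<bar>"
  using abs_le_sqrt_iff[of r \<delta>] by (simp add: S_def)

lemma shrink_small: "r\<^sup>2 \<le> \<delta> \<Longrightarrow> shrink \<delta> r = 0"
  by (simp add: shrink_def abs_le_sqrt_iff)

lemma shrink_large: "\<delta> < r\<^sup>2 \<Longrightarrow> shrink \<delta> r = r - \<delta> / r"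
  using abs_le_sqrt_iff[of r \<delta>] by (simp add: shrink_def)

lemma abs_shrink_large:
  assumes "\<delta> < r\<^sup>2" "0 < \<delta>"
  shows "\<bar>shrink \<delta> r\<bar> = \<bar>r\<bar> - \<delta> / \<bar>r\<bar>"
proof -
  have r: "r \<noteq> 0" using assms by auto
  have "\<delta> / \<bar>r\<bar> \<le> \<bar>r\<bar>" using assms r by (simp add: pos_divide_le_eq power2_eq_square flip: abs_mult)
  moreover have "r - \<delta> / r = sgn r * (\<bar>r\<bar> - \<delta> / \<bar>r\<bar>)" using r by (simp add: sgn_if)
  ultimately show ?thesis using r by (simp add: shrink_large[OF assms(1)] abs_mult abs_sgn_eq)
qed

text \<open>Makes the minimiser in \<open>z\<close> admissible in the quadratic upper bound, which
  is assumed for \<open>z\<close> dominated by \<open>S\<close>.\<close>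

lemma abs_shrink_le_S: "0 < \<delta> \<Longrightarrow> \<bar>shrink \<delta> r\<bar> \<le> S \<delta> r"
  using S_small(1)[of r \<delta>] abs_shrink_large[of \<delta> r]
  by (cases "r\<^sup>2 \<le> \<delta>") (auto simp: shrink_small S_large)

text \<open>Up to the threshold, the cross term \<open>r * z\<close> of the square is at most the
  penalty, because \<open>S\<close> does not exceed the square root of \<delta>. Beyond it,
  \<open>\<bar>z\<bar> / \<bar>r\<bar>\<close> is at least \<open>z / r\<close>, and completing the
  square in \<open>z\<close> exhibits the minimiser \<open>r - \<delta> / r\<close>.\<close>

lemma loss_le:
  assumes "0 < \<delta>"
  shows "loss \<delta> r \<le> 1 / 2 * (r - z)\<^sup>2 + \<delta> * (\<bar>z\<bar> / S \<delta> r)"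
proof (cases "r\<^sup>2 \<le> \<delta>")
  case True
  let ?s = "sqrt \<delta>"
  have "\<bar>r\<bar> \<le> ?s" using True by (simp only: abs_le_sqrt_iff)
  have "r * z \<le> \<bar>r\<bar> * \<bar>z\<bar>" by (metis abs_ge_self abs_mult)
  also have "\<dots> \<le> ?s * \<bar>z\<bar>" using \<open>\<bar>r\<bar> \<le> ?s\<close> by (rule mult_right_mono) simp
  also have "\<dots> = \<delta> * (\<bar>z\<bar> / ?s)" using assms by (simp add: field_simps)
  also have "\<dots> \<le> \<delta> * (\<bar>z\<bar> / S \<delta> r)"
    using S_small[OF True assms] assms by (intro mult_left_mono divide_left_mono) auto
  finally have "r * z \<le> \<delta> * (\<bar>z\<bar> / S \<delta> r)" .
  moreover have "1 / 2 * (r - z)\<^sup>2 + r * z = r\<^sup>2 / 2 + z\<^sup>2 / 2" by (simp add: power2_eq_square field_simps)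
  moreover have "0 \<le> z\<^sup>2 / 2" by simp
  ultimately show ?thesis unfolding loss_small[OF True assms] by linarith
next
  case False
  then have F: "\<delta> < r\<^sup>2" by simp
  have r: "r \<noteq> 0" using F assms by auto
  have "z / r \<le> \<bar>z\<bar> / \<bar>r\<bar>" by (metis abs_divide abs_ge_self)
  then have "\<delta> * (z / r) \<le> \<delta> * (\<bar>z\<bar> / S \<delta> r)" unfolding S_large[OF F] using assms by (intro mult_left_mono) auto
  moreover have "1 / 2 * (r - z)\<^sup>2 + \<delta> * (z / r) = \<delta> - \<delta>\<^sup>2 / (2 * r\<^sup>2) + 1 / 2 * (r - z - \<delta> / r)\<^sup>2"
    using r by (simp add: power2_eq_square field_simps)
  moreover have "0 \<le> 1 / 2 * (r - z - \<delta> / r)\<^sup>2" by simp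
  ultimately show ?thesis unfolding loss_large[OF F] by linarith
qed

lemma loss_shrink:
  assumes "0 < \<delta>"
  shows "1 / 2 * (r - shrink \<delta> r)\<^sup>2 + \<delta> * (\<bar>shrink \<delta> r\<bar> / S \<delta> r) = loss \<delta> r"
proof (cases "r\<^sup>2 \<le> \<delta>")
  case True
  then show ?thesis using assms by (simp add: shrink_small loss_small)
next
  case False
  then have F: "\<delta> < r\<^sup>2" by simp
  have r: "r \<noteq> 0" using F assms by auto
  have e1: "\<bar>shrink \<delta> r\<bar> / S \<delta> r = 1 - \<delta> / r\<^sup>2"
    unfolding S_large[OF F] abs_shrink_large[OF F assms] using r
    by (simp add: diff_divide_distrib power2_eq_square flip: abs_mult)
  have e2: "(r - shrink \<delta> r)\<^sup>2 = \<delta>\<^sup>2 / r\<^sup>2" by (simp add: shrink_large[OF F] power_divide)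
  show ?thesis unfolding loss_large[OF F] e1 e2 using r by (simp add: power2_eq_square field_simps)
qed

text \<open>An envelope identity: the left side is the partial derivative in \<open>r\<close> of the
  scalar objective with \<open>z\<close> frozen at its minimiser, and it agrees with the derivative
  of the minimal value.\<close>

lemma loss_deriv_shrink:
  assumes "0 < \<delta>"
  shows "(r - shrink \<delta> r) - \<delta> * (\<bar>shrink \<delta> r\<bar> * S' \<delta> r / (S \<delta> r)\<^sup>2) = loss_deriv \<delta> r"
proof (cases "r\<^sup>2 \<le> \<delta>")
  case True
  then show ?thesis using assms by (simp add: shrink_small loss_deriv_small)
next
  case False
  then have F: "\<delta> < r\<^sup>2" by simp
  have r: "r \<noteq> 0" using F assms by auto
  have S': "S' \<delta> r = sgn r" using F abs_le_sqrt_iff[of r \<delta>] by (simp add: S'_def)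
  have e: "\<bar>shrink \<delta> r\<bar> * S' \<delta> r = r - \<delta> / r"
    unfolding abs_shrink_large[OF F assms] S' using r
    by (cases "r > 0") (simp_all add: algebra_simps)
  show ?thesis
    unfolding loss_deriv_large[OF F assms] S_large[OF F] shrink_large[OF F] e[unfolded shrink_large[OF F]] using r
    by (simp add: power2_eq_square power3_eq_cube field_simps)
qed

section \<open>Lipschitz estimates\<close>

definition bounded_lipschitz :: "(real \<Rightarrow> real) \<Rightarrow> bool" where
  "bounded_lipschitz f \<longleftrightarrow> (\<exists>A a. 0 \<le> A \<and> (\<forall>x y. \<bar>f x - f y\<bar> \<le> A * \<bar>x - y\<bar>) \<and> (\<forall>x. \<bar>f x\<bar> \<le> a))"

text \<open>Boundedness is carried along because the increment of a product multiplies the increment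
  of one factor by a value of the other.\<close>

lemma bounded_lipschitz_mult:
  assumes "bounded_lipschitz f" "bounded_lipschitz g"
  shows "bounded_lipschitz (\<lambda>x. f x * g x)"
proof -
  obtain A a where A: "0 \<le> A" "\<And>x y. \<bar>f x - f y\<bar> \<le> A * \<bar>x - y\<bar>" "\<And>x. \<bar>f x\<bar> \<le> a"
    using assms(1) unfolding bounded_lipschitz_def by blast
  obtain B b where B: "0 \<le> B" "\<And>x y. \<bar>g x - g y\<bar> \<le> B * \<bar>x - y\<bar>" "\<And>x. \<bar>g x\<bar> \<le> b"
    using assms(2) unfolding bounded_lipschitz_def by blast
  have ab: "0 \<le> a" "0 \<le> b" using A(3)[of 0] B(3)[of 0] by linarith+
  have "\<bar>f x * g x - f y * g y\<bar> \<le> (A * b + a * B) * \<bar>x - y\<bar>" for x y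
  proof -
    have "f x * g x - f y * g y = (f x - f y) * g x + f y * (g x - g y)" by (simp add: algebra_simps)
    then have "\<bar>f x * g x - f y * g y\<bar> \<le> \<bar>f x - f y\<bar> * \<bar>g x\<bar> + \<bar>f y\<bar> * \<bar>g x - g y\<bar>"
      by (metis abs_mult abs_triangle_ineq)
    also have "\<dots> \<le> (A * \<bar>x - y\<bar>) * b + a * (B * \<bar>x - y\<bar>)"
      using A B ab by (intro add_mono mult_mono) auto
    finally show ?thesis by (simp add: algebra_simps)
  qed
  moreover have "\<bar>f x * g x\<bar> \<le> a * b" for x
    unfolding abs_mult using A(3) B(3) ab by (intro mult_mono) auto
  moreover have "0 \<le> A * b + a * B" using A B ab by simp
  ultimately show ?thesis unfolding bounded_lipschitz_def by blast
qed

lemma bounded_lipschitz_clamp_and_reciprocal: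
  assumes "0 < (s::real)"
  shows "bounded_lipschitz (\<lambda>r. max (-s) (min s r))" "bounded_lipschitz (\<lambda>r. inverse (max \<bar>r\<bar> s))"
proof -
  have "\<bar>max (-s) (min s x) - max (-s) (min s y)\<bar> \<le> 1 * \<bar>x - y\<bar>" for x y
    by (auto simp: max_def min_def abs_if)
  moreover have "\<bar>max (-s) (min s x)\<bar> \<le> s" for x using assms by (auto simp: max_def min_def abs_if)
  ultimately show "bounded_lipschitz (\<lambda>r. max (-s) (min s r))"
    unfolding bounded_lipschitz_def by (meson zero_le_one)
  have "\<bar>inverse (max \<bar>x\<bar> s) - inverse (max \<bar>y\<bar> s)\<bar> \<le> inverse (s * s) * \<bar>x - y\<bar>" for x y
  proof -
    let ?a = "max \<bar>x\<bar> s" and ?b = "max \<bar>y\<bar> s"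
    have p: "s \<le> ?a" "s \<le> ?b" "0 < ?a" "0 < ?b" using assms by auto
    have "inverse ?a - inverse ?b = (?b - ?a) * inverse (?a * ?b)" using p by (simp add: field_simps)
    then have "\<bar>inverse ?a - inverse ?b\<bar> = \<bar>?b - ?a\<bar> * inverse (?a * ?b)" using p by (simp add: abs_mult)
    also have "\<dots> \<le> \<bar>x - y\<bar> * inverse (s * s)"
    proof (rule mult_mono)
      show "\<bar>?b - ?a\<bar> \<le> \<bar>x - y\<bar>" by (auto simp: max_def)
      show "inverse (?a * ?b) \<le> inverse (s * s)" using p assms by (intro le_imp_inverse_le mult_mono) auto
    qed (use p in auto)
    finally show ?thesis by (simp add: mult.commute)
  qed
  moreover have "\<bar>inverse (max \<bar>x\<bar> s)\<bar> \<le> inverse s" for x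
  proof -
    have "inverse (max \<bar>x\<bar> s) \<le> inverse s" using assms by (intro le_imp_inverse_le) auto
    moreover have "0 \<le> inverse (max \<bar>x\<bar> s)" using assms by simp
    ultimately show ?thesis by simp
  qed
  moreover have "0 \<le> inverse (s * s)" by simp
  ultimately show "bounded_lipschitz (\<lambda>r. inverse (max \<bar>r\<bar> s))"
    unfolding bounded_lipschitz_def by blast
qed

text \<open>With \<open>s = sqrt \<delta>\<close>, the clamp \<open>\<kappa>\<close> and the
  reciprocal \<open>\<rho>\<close> merge the two branches: \<open>loss_deriv\<close> is
  \<open>s ^ 3\<close> times \<open>\<kappa>\<close> times the cube of \<open>\<rho>\<close>, and
  \<open>shrink\<close> is the identity minus \<open>s\<close> times \<open>\<kappa>\<close> times
  \<open>\<rho>\<close>. The bounds follow from those for products, with no distinction of where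
  \<open>x\<close> and \<open>y\<close> lie relative to the threshold.\<close>

lemma loss_deriv_shrink_lipschitz:
  assumes \<delta>: "0 < \<delta>"
  shows "\<exists>C\<ge>0. \<forall>x y. \<bar>loss_deriv \<delta> x - loss_deriv \<delta> y\<bar> \<le> C * \<bar>x - y\<bar>" "\<exists>C\<ge>0. \<forall>x y. \<bar>shrink \<delta> x - shrink \<delta> y\<bar> \<le> C * \<bar>x - y\<bar>"
proof -
  define s where "s = sqrt \<delta>"
  have s: "0 < s" "\<delta> = s * s" using \<delta> by (auto simp: s_def)
  define \<kappa> \<rho> where "\<kappa> r = max (-s) (min s r)" and "\<rho> r = inverse (max \<bar>r\<bar> s)" for r
  have bl: "bounded_lipschitz \<kappa>" "bounded_lipschitz \<rho>"
    unfolding \<kappa>_def \<rho>_def using bounded_lipschitz_clamp_and_reciprocal[OF s(1)] by auto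
  have small: "\<kappa> r = r" "\<rho> r = inverse s" if "r\<^sup>2 \<le> \<delta>" for r
  proof -
    have "\<bar>r\<bar> \<le> s" using that unfolding s_def by (simp only: abs_le_sqrt_iff)
    then show "\<kappa> r = r" "\<rho> r = inverse s" by (auto simp: \<kappa>_def \<rho>_def max_def min_def)
  qed
  have large: "\<kappa> r = sgn r * s" "\<rho> r = inverse \<bar>r\<bar>" "r \<noteq> 0" if "\<delta> < r\<^sup>2" for r
  proof -
    have "\<not> \<bar>r\<bar> \<le> s" using that unfolding s_def by (simp only: abs_le_sqrt_iff not_le)
    then show "\<kappa> r = sgn r * s" "\<rho> r = inverse \<bar>r\<bar>" "r \<noteq> 0"
      using s(1) by (auto simp: \<kappa>_def \<rho>_def max_def min_def sgn_if)
  qed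
  have f1: "loss_deriv \<delta> r = s ^ 3 * (\<kappa> r * (\<rho> r * (\<rho> r * \<rho> r)))" for r
  proof (cases "r\<^sup>2 \<le> \<delta>")
    case True
    show ?thesis using s(1) by (simp add: loss_deriv_small[OF True \<delta>] small[OF True] power3_eq_cube field_simps)
  next
    case False
    then have F: "\<delta> < r\<^sup>2" by simp
    have "\<delta>\<^sup>2 = s ^ 4" by (simp add: s(2) power2_eq_square power4_eq_xxxx)
    then show ?thesis using s(1) large(3)[OF F]
      by (simp add: loss_deriv_large[OF F \<delta>] large(1,2)[OF F] power3_eq_cube power4_eq_xxxx sgn_if field_simps abs_if)
  qed
  have "bounded_lipschitz (\<lambda>r. \<kappa> r * (\<rho> r * (\<rho> r * \<rho> r)))" by (intro bounded_lipschitz_mult bl)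
  then obtain A where A: "0 \<le> A"
    "\<And>x y. \<bar>\<kappa> x * (\<rho> x * (\<rho> x * \<rho> x)) - \<kappa> y * (\<rho> y * (\<rho> y * \<rho> y))\<bar> \<le> A * \<bar>x - y\<bar>"
    unfolding bounded_lipschitz_def by blast
  have "\<bar>loss_deriv \<delta> x - loss_deriv \<delta> y\<bar> \<le> (s ^ 3 * A) * \<bar>x - y\<bar>" for x y
  proof -
    have "\<bar>loss_deriv \<delta> x - loss_deriv \<delta> y\<bar> = s ^ 3 * \<bar>\<kappa> x * (\<rho> x * (\<rho> x * \<rho> x)) - \<kappa> y * (\<rho> y * (\<rho> y * \<rho> y))\<bar>"
      using s(1) by (simp add: f1 abs_mult flip: right_diff_distrib)
    also have "\<dots> \<le> s ^ 3 * (A * \<bar>x - y\<bar>)" using A s(1) by (intro mult_left_mono) auto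
    finally show ?thesis by (simp add: mult.assoc)
  qed
  moreover have "0 \<le> s ^ 3 * A" using A s(1) by simp
  ultimately show "\<exists>C\<ge>0. \<forall>x y. \<bar>loss_deriv \<delta> x - loss_deriv \<delta> y\<bar> \<le> C * \<bar>x - y\<bar>" by blast
  have f2: "shrink \<delta> r = r - s * (\<kappa> r * \<rho> r)" for r
  proof (cases "r\<^sup>2 \<le> \<delta>")
    case True
    show ?thesis using s(1) by (simp add: shrink_small[OF True] small[OF True])
  next
    case False
    then have F: "\<delta> < r\<^sup>2" by simp
    have "s * (\<kappa> r * \<rho> r) = \<delta> / r"
      unfolding large(1,2)[OF F] s(2) using large(3)[OF F] by (simp add: sgn_if field_simps)
    then show ?thesis by (simp add: shrink_large[OF F])
  qed
  have "bounded_lipschitz (\<lambda>r. \<kappa> r * \<rho> r)" by (intro bounded_lipschitz_mult bl)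
  then obtain B where B: "0 \<le> B" "\<And>x y. \<bar>\<kappa> x * \<rho> x - \<kappa> y * \<rho> y\<bar> \<le> B * \<bar>x - y\<bar>"
    unfolding bounded_lipschitz_def by blast
  have "\<bar>shrink \<delta> x - shrink \<delta> y\<bar> \<le> (1 + s * B) * \<bar>x - y\<bar>" for x y
  proof -
    have "shrink \<delta> x - shrink \<delta> y = (x - y) - s * (\<kappa> x * \<rho> x - \<kappa> y * \<rho> y)"
      by (simp add: f2 algebra_simps)
    then have "\<bar>shrink \<delta> x - shrink \<delta> y\<bar> \<le> \<bar>x - y\<bar> + \<bar>s * (\<kappa> x * \<rho> x - \<kappa> y * \<rho> y)\<bar>"
      by (metis abs_triangle_ineq4)
    also have "\<bar>s * (\<kappa> x * \<rho> x - \<kappa> y * \<rho> y)\<bar> = s * \<bar>\<kappa> x * \<rho> x - \<kappa> y * \<rho> y\<bar>"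
      using s(1) by (simp add: abs_mult)
    also have "\<dots> \<le> s * (B * \<bar>x - y\<bar>)" using B s(1) by (intro mult_left_mono) auto
    finally show ?thesis by (simp add: algebra_simps)
  qed
  moreover have "0 \<le> 1 + s * B" using B s(1) by simp
  ultimately show "\<exists>C\<ge>0. \<forall>x y. \<bar>shrink \<delta> x - shrink \<delta> y\<bar> \<le> C * \<bar>x - y\<bar>" by blast
qed

text \<open>The difference quotient is at least \<open>- K * norm (a - b)\<close>, which tends to 0.
  A quadratic minorant touching at \<open>b\<close> thus replaces local minimality.\<close>

lemma zero_in_frechet_subdiff:
  fixes \<sigma> :: "'a::real_inner \<Rightarrow> real"
  assumes "\<And>a. \<sigma> b - K * (norm (a - b))\<^sup>2 \<le> \<sigma> a"
  shows "0 \<in> frechet_subdiff \<sigma> b"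
proof -
  have "0 \<le> Liminf (at b) (\<lambda>a. ereal ((\<sigma> a - \<sigma> b - inner 0 (a - b)) / norm (a - b)))"
    unfolding le_Liminf_iff
  proof (intro allI impI)
    fix y :: ereal assume "y < 0"
    have "((\<lambda>a. - K * norm (a - b)) \<longlongrightarrow> - K * norm (b - b)) (at b)" by (intro tendsto_intros)
    then have "((\<lambda>a. ereal (- K * norm (a - b))) \<longlongrightarrow> ereal 0) (at b)" by simp
    then have "eventually (\<lambda>a. y < ereal (- K * norm (a - b))) (at b)"
      using \<open>y < 0\<close> by (intro order_tendstoD(1)) (auto simp: zero_ereal_def)
    moreover have "eventually (\<lambda>a. a \<noteq> b) (at b)" by (auto simp: eventually_at_filter)
    ultimately show "eventually (\<lambda>a. y < ereal ((\<sigma> a - \<sigma> b - inner 0 (a - b)) / norm (a - b))) (at b)"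
    proof eventually_elim
      case (elim a)
      have "- K * norm (a - b) = (- K * (norm (a - b))\<^sup>2) / norm (a - b)"
        using elim(2) by (simp add: power2_eq_square)
      also have "\<dots> \<le> (\<sigma> a - \<sigma> b - inner 0 (a - b)) / norm (a - b)"
        using assms[of a] by (intro divide_right_mono) auto
      finally show ?case using elim(1) by (meson ereal_less_eq(3) less_le_trans)
    qed
  qed
  then show ?thesis by (simp add: frechet_subdiff_def)
qed

section \<open>The objective minimised over z, as a function of w\<close>

definition reduced_objective :: "real \<Rightarrow> real ^ 'm \<Rightarrow> real ^ 'n ^ 'm \<Rightarrow> real ^ 'n \<Rightarrow> real" where
  "reduced_objective \<delta> y X w = (\<Sum>i\<in>UNIV. loss \<delta> ((y - X *v w) $ i))"

definition grad_reduced :: "real \<Rightarrow> real ^ 'm \<Rightarrow> real ^ 'n ^ 'm \<Rightarrow> real ^ 'n \<Rightarrow> real ^ 'n" where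
  "grad_reduced \<delta> y X w = - (transpose X *v (\<chi> i. loss_deriv \<delta> ((y - X *v w) $ i)))"

lemma T_nth: "T \<delta> v $ i = shrink \<delta> (v $ i)"
  by (simp add: T_def shrink_def)

lemma H_eq_sum:
  fixes y :: "real ^ 'm"
  shows "H \<delta> y X (w, z) = (\<Sum>i\<in>UNIV. 1 / 2 * ((y - X *v w) $ i - z $ i)\<^sup>2 + \<delta> * (\<bar>z $ i\<bar> / S \<delta> ((y - X *v w) $ i)))"
proof -
  have "(norm v)\<^sup>2 = (\<Sum>i\<in>UNIV. (v $ i)\<^sup>2)" for v :: "real ^ 'm"
    by (simp add: norm_vec_def L2_set_def sum_nonneg)
  then show ?thesis by (simp add: H_def sum.distrib sum_distrib_left)
qed

lemma reduced_objective_le_H: "0 < \<delta> \<Longrightarrow> reduced_objective \<delta> y X w \<le> H \<delta> y X (w, z)"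
  unfolding reduced_objective_def H_eq_sum by (intro sum_mono loss_le)

lemma H_T: "0 < \<delta> \<Longrightarrow> H \<delta> y X (w, T \<delta> (y - X *v w)) = reduced_objective \<delta> y X w"
  unfolding reduced_objective_def H_eq_sum T_nth by (simp only: loss_shrink)

lemma grad_w_H_T:
  assumes "0 < \<delta>"
  shows "grad_w_H \<delta> y X w (T \<delta> (y - X *v w)) = grad_reduced \<delta> y X w"
proof -
  define r where "r = y - X *v w"
  define v where "v = (\<chi> i. \<bar>T \<delta> r $ i\<bar> * S' \<delta> (r $ i) / (S \<delta> (r $ i))\<^sup>2)"
  have "(r - T \<delta> r) - \<delta> *\<^sub>R v = (\<chi> i. loss_deriv \<delta> (r $ i))"
    using loss_deriv_shrink[OF assms] by (simp add: vec_eq_iff v_def T_nth)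
  then have "grad_reduced \<delta> y X w = - (transpose X *v ((r - T \<delta> r) - \<delta> *\<^sub>R v))"
    by (simp add: grad_reduced_def r_def)
  also have "\<dots> = - (transpose X *v (r - T \<delta> r)) + \<delta> *\<^sub>R (transpose X *v v)"
    by (simp add: matrix_vector_mult_diff_distrib matrix_vector_mult_scaleR)
  finally show ?thesis by (simp add: grad_w_H_def r_def v_def)
qed

lemma norm_componentwise_lipschitz:
  fixes a b :: "real ^ 'm"
  assumes "0 \<le> C" "\<And>x y. \<bar>f x - f y\<bar> \<le> C * \<bar>x - y\<bar>"
  shows "norm ((\<chi> i. f (a $ i)) - (\<chi> i. f (b $ i))) \<le> C * norm (a - b)"
proof -
  have "norm ((\<chi> i. f (a $ i)) - (\<chi> i. f (b $ i))) \<le> norm (C *\<^sub>R (a - b))"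
    using assms by (intro norm_le_componentwise_cart) (simp add: abs_mult)
  then show ?thesis using assms(1) by simp
qed

lemma matrix_vector_mult_bounded:
  fixes A :: "real ^ 'n ^ 'm"
  obtains K where "0 \<le> K" "\<And>x. norm (A *v x) \<le> K * norm x"
  using onorm_pos_le[OF matrix_vector_mul_bounded_linear[of A]] onorm[OF matrix_vector_mul_bounded_linear[of A]]
  by blast

lemma grad_reduced_lipschitz:
  assumes "0 < \<delta>"
  shows "\<exists>C\<ge>0. \<forall>x u. norm (grad_reduced \<delta> y X u - grad_reduced \<delta> y X x) \<le> C * norm (u - x)"
proof -
  obtain K where K: "0 \<le> K" "\<And>x. norm (X *v x) \<le> K * norm x" using matrix_vector_mult_bounded by blast
  obtain K' where K': "0 \<le> K'" "\<And>x. norm (transpose X *v x) \<le> K' * norm x" using matrix_vector_mult_bounded by blast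
  obtain C where C: "0 \<le> C" "\<And>x y. \<bar>loss_deriv \<delta> x - loss_deriv \<delta> y\<bar> \<le> C * \<bar>x - y\<bar>"
    using loss_deriv_shrink_lipschitz(1)[OF assms] by blast
  have "norm (grad_reduced \<delta> y X u - grad_reduced \<delta> y X x) \<le> (K' * C * K) * norm (u - x)" for x u
  proof -
    define p where "p w = (\<chi> i. loss_deriv \<delta> ((y - X *v w) $ i))" for w
    have "grad_reduced \<delta> y X u - grad_reduced \<delta> y X x = transpose X *v (p x - p u)"
      by (simp add: grad_reduced_def p_def matrix_vector_mult_diff_distrib)
    also have "norm \<dots> \<le> K' * norm (p x - p u)" by (rule K')
    also have "norm (p x - p u) \<le> C * norm ((y - X *v x) - (y - X *v u))"
      unfolding p_def by (rule norm_componentwise_lipschitz[OF C])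
    also have "(y - X *v x) - (y - X *v u) = X *v (u - x)" by (simp add: matrix_vector_mult_diff_distrib)
    also have "norm \<dots> \<le> K * norm (u - x)" by (rule K)
    finally show ?thesis using K' C by (simp add: mult_left_mono mult.assoc)
  qed
  moreover have "0 \<le> K' * C * K" using K K' C by simp
  ultimately show ?thesis by blast
qed

text \<open>Carries summability of the steps and convergence over from the \<open>w\<close>
  component to the \<open>z\<close> component.\<close>

lemma T_residual_lipschitz:
  fixes y :: "real ^ 'm"
  assumes "0 < \<delta>"
  shows "\<exists>C\<ge>0. \<forall>x u. norm (T \<delta> (y - X *v u) - T \<delta> (y - X *v x)) \<le> C * norm (u - x)"
proof -
  obtain K where K: "0 \<le> K" "\<And>x. norm (X *v x) \<le> K * norm x" using matrix_vector_mult_bounded by blast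
  obtain C where C: "0 \<le> C" "\<And>x y. \<bar>shrink \<delta> x - shrink \<delta> y\<bar> \<le> C * \<bar>x - y\<bar>"
    using loss_deriv_shrink_lipschitz(2)[OF assms] by blast
  have T: "T \<delta> v = (\<chi> i. shrink \<delta> (v $ i))" for v :: "real ^ 'm" by (simp add: vec_eq_iff T_nth)
  have "norm (T \<delta> (y - X *v u) - T \<delta> (y - X *v x)) \<le> (C * K) * norm (u - x)" for x u
  proof -
    have "norm (T \<delta> (y - X *v u) - T \<delta> (y - X *v x)) \<le> C * norm ((y - X *v u) - (y - X *v x))"
      unfolding T by (rule norm_componentwise_lipschitz[OF C])
    also have "(y - X *v u) - (y - X *v x) = X *v (x - u)" by (simp add: matrix_vector_mult_diff_distrib)
    also have "norm \<dots> \<le> K * norm (x - u)" by (rule K)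
    finally show ?thesis using C by (simp add: mult_left_mono mult.assoc norm_minus_commute)
  qed
  moreover have "0 \<le> C * K" using K C by simp
  ultimately show ?thesis by blast
qed

lemma continuous_on_reduced_objective:
  assumes "0 < \<delta>"
  shows "continuous_on UNIV (reduced_objective \<delta> y X)"
proof -
  have "max (r\<^sup>2) \<delta> \<noteq> 0" for r :: real
    using max.cobounded2[of \<delta> "r\<^sup>2"] assms by linarith
  then show ?thesis unfolding reduced_objective_def loss_def
    by (intro continuous_intros matrix_vector_mult_linear_continuous_on) auto
qed

lemma semialg_fun_loss:
  assumes "p \<in> polyfun"
  shows "semialg_fun (\<lambda>e. loss \<delta> (p e))" "semialg_fun (\<lambda>e. loss_deriv \<delta> (p e))"
proof -
  have p: "semialg_fun p" "semialg_fun (\<lambda>e. (p e)\<^sup>2)"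
    using assms by (auto intro: semialg_fun_polyfun semialg_fun_polyfun[OF polyfun_power])
  have c: "semialg_fun (\<lambda>e. k)" for k by (intro semialg_fun_polyfun polyfun_const)
  \<comment> \<open>Inverses are available for polynomials, so the maximum is split into its two
    cases before inverting.\<close>
  have "inverse (max (x\<^sup>2) \<delta>) = (if x\<^sup>2 \<le> \<delta> then inverse \<delta> else inverse (x\<^sup>2))" for x by (simp add: max_def)
  then have i: "semialg_fun (\<lambda>e. inverse (max ((p e)\<^sup>2) \<delta>))"
    using assms p c by (simp only:) (intro semialg_fun_if semialg_fun_le semialg_fun_inverse_polyfun polyfun_power polyfun_const)
  have m: "semialg_fun (\<lambda>e. max ((p e)\<^sup>2) \<delta>)" by (intro semialg_fun_max p c)
  have "semialg_fun (\<lambda>e. \<delta> - \<delta>\<^sup>2 / 2 * inverse (max ((p e)\<^sup>2) \<delta>) + ((p e)\<^sup>2 - max ((p e)\<^sup>2) \<delta>) * (1 / 2))"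
    by (intro semialg_fun_add semialg_fun_diff semialg_fun_mult i m p c)
  then show "semialg_fun (\<lambda>e. loss \<delta> (p e))" by (simp add: loss_def)
  show "semialg_fun (\<lambda>e. loss_deriv \<delta> (p e))"
    unfolding loss_deriv_def by (intro semialg_fun_mult semialg_fun_power i p c)
qed

lemma polyfun_residual: "(\<lambda>e. (y - X *v (\<chi> j. e (v j))) $ i) \<in> polyfun"
  by (simp add: matrix_vector_mult_def) (intro polyfun_intros)

lemma semialg_reduced_objective: "semialg (\<lambda>e :: 'n::finite option \<Rightarrow> real. reduced_objective \<delta> y X (\<chi> i. e (Some i)) = e None)"
  unfolding reduced_objective_def
  by (intro semialg_fun_eq semialg_fun_sum semialg_fun_loss polyfun_residual semialg_fun_polyfun polyfun_var)

lemma semialg_norm_grad_reduced: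
  "semialg (\<lambda>e :: 'n::finite + 'n \<Rightarrow> real.
     norm (grad_reduced \<delta> y X (\<chi> i. e (Inl i))) \<le> norm (grad_reduced \<delta> y X (\<chi> i. e (Inr i))))"
proof -
  have comp: "grad_reduced \<delta> y X w $ j = (\<Sum>i\<in>UNIV. - (X $ i $ j) * loss_deriv \<delta> ((y - X *v w) $ i))" for w j
    by (simp add: grad_reduced_def matrix_vector_mult_def transpose_def sum_negf)
  have sq: "semialg_fun (\<lambda>e :: 'n + 'n \<Rightarrow> real. \<Sum>j\<in>UNIV. (grad_reduced \<delta> y X (\<chi> i. e (v i)) $ j)\<^sup>2)" for v
    unfolding comp
    by (intro semialg_fun_sum semialg_fun_power semialg_fun_mult semialg_fun_loss polyfun_residual
        semialg_fun_polyfun polyfun_const)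
  have "norm a \<le> norm b \<longleftrightarrow> (\<Sum>j\<in>UNIV. (a $ j)\<^sup>2) \<le> (\<Sum>j\<in>UNIV. (b $ j)\<^sup>2)" for a b :: "real ^ 'n"
    by (simp add: norm_vec_def L2_set_def)
  then show ?thesis using semialg_fun_le[OF sq sq, of Inl Inr] by simp
qed

section \<open>Convergence of the iteration to a critical point\<close>

theorem theorem3:
  fixes y :: "real^'m" and X :: "real^'n^'m" and \<delta> L \<alpha> :: real
  assumes XtX: "transpose X ** X = mat 1"
    and \<delta>_pos: "\<delta> > 0"
    and L_pos: "L > 0"
    and L_bound: "\<And>w w' z. (\<forall>i. \<bar>z $ i\<bar> \<le> S \<delta> ((y - X *v w) $ i)) \<Longrightarrow>
        H \<delta> y X (w', z) \<le> H \<delta> y X (w, z) + inner (grad_w_H \<delta> y X w z) (w' - w)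
          + L / 2 * (norm (w' - w))\<^sup>2"
    and \<alpha>_pos: "0 < \<alpha>" and \<alpha>_lt: "\<alpha> < 2 / L"
    and bdd: "bounded (range (sarm \<delta> y X \<alpha>))"
  shows "summable (\<lambda>k. norm (sarm \<delta> y X \<alpha> (Suc (Suc k)) - sarm \<delta> y X \<alpha> (Suc k)))
       \<and> (\<exists>p. sarm \<delta> y X \<alpha> \<longlonglongrightarrow> p \<and> critical_point (H \<delta> y X) p)"
proof -
  let ?F = "reduced_objective \<delta> y X" and ?G = "grad_reduced \<delta> y X" and ?Z = "\<lambda>w. T \<delta> (y - X *v w)"
  \<comment> \<open>Shifted by one: the starting \<open>z\<close> is 0 and may differ from the
    minimiser for the starting \<open>w\<close>. From the next index on the iterates have the form
    \<open>(w, ?Z w)\<close>.\<close>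
  define w where "w k = fst (sarm \<delta> y X \<alpha> (Suc k))" for k
  have sarm: "sarm \<delta> y X \<alpha> (Suc k) = (w k, ?Z (w k))" for k by (simp add: w_def Let_def)
  have w: "w (Suc k) = w k - \<alpha> *\<^sub>R ?G (w k)" for k
  proof -
    have "w (Suc k) = fst (sarm \<delta> y X \<alpha> (Suc k)) - \<alpha> *\<^sub>R
        grad_w_H \<delta> y X (fst (sarm \<delta> y X \<alpha> (Suc k))) (snd (sarm \<delta> y X \<alpha> (Suc k)))"
      unfolding w_def by (subst sarm.simps(2)) (simp only: Let_def fst_conv)
    then show ?thesis unfolding sarm by (simp add: grad_w_H_T[OF \<delta>_pos])
  qed
  \<comment> \<open>Majorisation: \<open>?F u\<close> is at most the value of \<open>H\<close> at
    \<open>(u, ?Z x)\<close>, and the bound for \<open>H\<close> with \<open>z\<close> frozen at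
    \<open>?Z x\<close> has \<open>?F x\<close> and \<open>?G x\<close> on its right side because
    \<open>?Z x\<close> is the minimiser for \<open>x\<close>.\<close>
  have up: "?F u \<le> ?F x + ?G x \<bullet> (u - x) + L / 2 * (norm (u - x))\<^sup>2" for x u
  proof -
    have "\<forall>i. \<bar>?Z x $ i\<bar> \<le> S \<delta> ((y - X *v x) $ i)"
      using abs_shrink_le_S[OF \<delta>_pos] by (simp add: T_nth)
    from L_bound[OF this, of u] show ?thesis
      using reduced_objective_le_H[OF \<delta>_pos, of y X u "?Z x"] by (simp add: H_T[OF \<delta>_pos] grad_w_H_T[OF \<delta>_pos])
  qed
  obtain C where C: "0 \<le> C" "\<And>x u. norm (?G u - ?G x) \<le> C * norm (u - x)"
    using grad_reduced_lipschitz[OF \<delta>_pos] by blast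
  obtain D where D: "0 \<le> D" "\<And>x u. norm (?Z u - ?Z x) \<le> D * norm (u - x)"
    using T_residual_lipschitz[OF \<delta>_pos] by blast
  obtain M where M: "\<And>k. norm (w k) \<le> M"
  proof -
    obtain M where M: "\<And>k. norm (sarm \<delta> y X \<alpha> k) \<le> M" using bdd unfolding bounded_iff by blast
    have "norm (w k) \<le> M" for k
      using M[of "Suc k"] norm_fst_le[of "w k" "?Z (w k)"] unfolding sarm by linarith
    then show ?thesis using that by blast
  qed
  have sum_w: "summable (\<lambda>k. norm (w (Suc k) - w k))"
    by (rule semialg_gradient_descent_finite_length[where F = ?F and G = ?G and w = w, OF semialg_reduced_objective semialg_norm_grad_reduced
          continuous_on_reduced_objective[OF \<delta>_pos] L_pos up C \<alpha>_pos \<alpha>_lt w M])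
  have "norm (sarm \<delta> y X \<alpha> (Suc (Suc k)) - sarm \<delta> y X \<alpha> (Suc k)) \<le> (1 + D) * norm (w (Suc k) - w k)" for k
  proof -
    have "norm (sarm \<delta> y X \<alpha> (Suc (Suc k)) - sarm \<delta> y X \<alpha> (Suc k))
        = norm (w (Suc k) - w k, ?Z (w (Suc k)) - ?Z (w k))" unfolding sarm by simp
    also have "\<dots> \<le> norm (w (Suc k) - w k) + norm (?Z (w (Suc k)) - ?Z (w k))" by (rule norm_Pair_le)
    also have "\<dots> \<le> (1 + D) * norm (w (Suc k) - w k)" using D(2)[of "w (Suc k)" "w k"] by (simp add: algebra_simps)
    finally show ?thesis .
  qed
  then have sum_sarm: "summable (\<lambda>k. norm (sarm \<delta> y X \<alpha> (Suc (Suc k)) - sarm \<delta> y X \<alpha> (Suc k)))"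
    by (intro summable_comparison_test'[OF summable_mult[OF sum_w, of "1 + D"], of 0]) simp
  have "summable (\<lambda>k. w (Suc k) - w k)" using sum_w by (rule summable_norm_cancel)
  then have "(\<lambda>n. \<Sum>k<n. w (Suc k) - w k) \<longlonglongrightarrow> (\<Sum>k. w (Suc k) - w k)" by (rule summable_LIMSEQ)
  then have "(\<lambda>n. w n - w 0) \<longlonglongrightarrow> (\<Sum>k. w (Suc k) - w k)" by (simp add: sum_lessThan_telescope)
  then have "(\<lambda>n. (w n - w 0) + w 0) \<longlonglongrightarrow> (\<Sum>k. w (Suc k) - w k) + w 0" by (intro tendsto_intros)
  then obtain w' where w': "w \<longlonglongrightarrow> w'" by auto
  have cont: "isCont g w'" if "0 \<le> K" "\<And>x u. norm (g u - g x) \<le> K * norm (u - x)"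
    for K and g :: "real^'n \<Rightarrow> 'b::real_normed_vector"
  proof -
    have "K-lipschitz_on UNIV g" using that by (intro lipschitz_onI) (auto simp: dist_norm)
    then show ?thesis using lipschitz_on_continuous_on continuous_on_eq_continuous_at by blast
  qed
  have "(\<lambda>k. ?Z (w k)) \<longlonglongrightarrow> ?Z w'" by (rule isCont_tendsto_compose[OF cont[OF D] w'])
  then have "(\<lambda>k. sarm \<delta> y X \<alpha> (Suc k)) \<longlonglongrightarrow> (w', ?Z w')" unfolding sarm using w' by (intro tendsto_Pair)
  then have conv: "sarm \<delta> y X \<alpha> \<longlonglongrightarrow> (w', ?Z w')" by (simp only: filterlim_sequentially_Suc)
  have G0: "?G w' = 0"
  proof -
    have "(\<lambda>k. (- 1 / \<alpha>) *\<^sub>R (w (Suc k) - w k)) \<longlonglongrightarrow> (- 1 / \<alpha>) *\<^sub>R (w' - w')"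
      using w' by (intro tendsto_intros LIMSEQ_Suc)
    moreover have "(- 1 / \<alpha>) *\<^sub>R (w (Suc k) - w k) = ?G (w k)" for k using w \<alpha>_pos by simp
    ultimately have "(\<lambda>k. ?G (w k)) \<longlonglongrightarrow> 0" by simp
    moreover have "(\<lambda>k. ?G (w k)) \<longlonglongrightarrow> ?G w'" by (rule isCont_tendsto_compose[OF cont[OF C] w'])
    ultimately show ?thesis using LIMSEQ_unique by blast
  qed
  \<comment> \<open>A lower bound obtained from an upper one: \<open>up\<close> is applied with base
    point \<open>u\<close> and target \<open>w'\<close>. As \<open>?G w'\<close> vanishes, the
    gradient at \<open>u\<close> has norm at most \<open>C * norm (u - w')\<close>, which explains
    the constant \<open>C + L / 2\<close>.\<close>
  have "H \<delta> y X (w', ?Z w') - (C + L / 2) * (norm (a - (w', ?Z w')))\<^sup>2 \<le> H \<delta> y X a" for a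
  proof -
    obtain u z where a: "a = (u, z)" by (cases a)
    have "norm (u - w') \<le> norm (a - (w', ?Z w'))"
      using norm_fst_le[of "u - w'" "z - ?Z w'"] by (simp add: a)
    then have sq: "(norm (u - w'))\<^sup>2 \<le> (norm (a - (w', ?Z w')))\<^sup>2" by (intro power_mono) auto
    have "?F w' \<le> ?F u + ?G u \<bullet> (w' - u) + L / 2 * (norm (u - w'))\<^sup>2"
      using up[of w' u] by (simp add: norm_minus_commute)
    also have "?G u \<bullet> (w' - u) \<le> norm (?G u) * norm (w' - u)" by (rule norm_cauchy_schwarz)
    also have "norm (?G u) \<le> C * norm (u - w')" using C(2)[of u w'] by (simp add: G0)
    finally have "?F w' \<le> ?F u + (C + L / 2) * (norm (u - w'))\<^sup>2"
      by (simp add: mult_right_mono norm_minus_commute power2_eq_square algebra_simps)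
    moreover have "(C + L / 2) * (norm (u - w'))\<^sup>2 \<le> (C + L / 2) * (norm (a - (w', ?Z w')))\<^sup>2"
      using sq C(1) L_pos by (intro mult_left_mono) auto
    ultimately show ?thesis
      using reduced_objective_le_H[OF \<delta>_pos, of y X u z] unfolding H_T[OF \<delta>_pos] a by linarith
  qed
  then have "0 \<in> frechet_subdiff (H \<delta> y X) (w', ?Z w')" by (rule zero_in_frechet_subdiff)
  then have "critical_point (H \<delta> y X) (w', ?Z w')"
    unfolding critical_point_def limiting_subdiff_def
    by (intro CollectI exI[of _ "\<lambda>_. (w', ?Z w')"] exI[of _ "\<lambda>_. 0"]) simp
  then show ?thesis using sum_sarm conv by blast
qed

end
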